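(* Let $x$ be a root of unity, let $a\in\mathbb{C}\setminus\mathbb{Z}$ and let $q$ be a positive integer with $(q,x)\neq(1,1)$. Then \[ \sum_{n=-\infty}^{\infty}\frac{4^{n+a}}{(n+a)^q\binom{2n+2a}{n+a}}x^{-n}-(-1)^q\Big(\mathrm{Li}_1(x;1-a)-x\,\mathrm{Li}_1(x^{-1};a)\Big)\sum_{n=1}^\infty\frac{\binom{2n}{n}}{n^{q-1}4^n}x^n \] \[ =\sum_{\substack{k_1+k_2+k_3+k_4+k_5=q-1\\ k_1,\dots,k_5\ge 0}}\frac{C_{k_1}C_{k_2}D_{k_3}\,2^{k_3+k_4}}{k_1!\,k_2!\,k_3!\,k_4!}\log^{k_4}(2)\Big(x\,\mathrm{Li}_{k_5+1}(x^{-1};a)-(-1)^{k_5}\mathrm{Li}_{k_5+1}(x;1-a)\Big). \]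
   Context: Generalized binomial coefficients are defined by $\binom{\alpha}{\beta}=\frac{\Gamma(\alpha+1)}{\Gamma(\beta+1)\Gamma(\alpha-\beta+1)}$; thus $\binom{2n+2a}{n+a}^{-1}=\frac{\Gamma(n+a+1)^2}{\Gamma(2n+2a+1)}$, and by convention, when $a$ is a half-integer and $2n+2a$ is a non-positive integer, $\binom{2n+2a}{n+a}^{-1}$ is taken to be $0$. For $p\in\mathbb{N}$, $b\in\mathbb{C}\setminus\{-1,-2,\dots\}$ and $x$ a root of unity with $(p,x)\neq(1,1)$, the cyclotomic Hurwitz zeta function is $\mathrm{Li}_p(x;b+1):=\sum_{n=1}^\infty \frac{x^n}{(n+b)^p}$; so $\mathrm{Li}_p(x;1-a)=\sum_{n\ge1}\frac{x^n}{(n-a)^p}$ and $\mathrm{Li}_p(x^{-1};a)=\sum_{n\ge1}\frac{x^{-n}}{(n+a-1)^p}$. When $x=1$, the combination $\mathrm{Li}_1(x;1-a)-x\mathrm{Li}_1(x^{-1};a)$ (and its negative) is understood as the convergent series $\sum_{n\ge1}\big(\frac{x^n}{n-a}-\frac{x^{1-n}}{n+a-1}\big)$. The exponential complete Bell polynomials $Y_n$ are defined by $\exp\big(\sum_{k\ge1}x_k\frac{t^k}{k!}\big)=\sum_{n\ge0}Y_n(x_1,\dots,x_n)\frac{t^n}{n!}$. Here $C_n:=Y_n(x_1,\dots,x_n)$ with $x_1=0$ and $x_k=(-1)^k(k-1)!\zeta(k)$ for $k\ge2$, and $D_n:=Y_n(x_1,\dots,x_n)$ with $x_1=0$ and $x_k=(-1)^{k-1}(k-1)!\zeta(k)$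 for $k\ge2$, where $\zeta$ is the Riemann zeta function. *)

theory Defs
  imports
    "HOL-Analysis.Analysis"
    "HOL-Computational_Algebra.Formal_Power_Series"
begin

definition gen_binomial :: "complex \<Rightarrow> complex \<Rightarrow> complex" where
  "gen_binomial \<alpha> \<beta> = Gamma (\<alpha> + 1) / (Gamma (\<beta> + 1) * Gamma (\<alpha> - \<beta> + 1))"

text \<open>
  \<^const>\<open>Gamma\<close> is \<open>0\<close> at its poles and \<open>1 / 0 = 0\<close>. Hence, for a half-integer \<open>m\<close>
  such that \<open>2 * m\<close> is a negative integer, the reciprocal of the central binomial coefficient
  is \<open>0\<close>; this is the continuous extension of
  \<open>Gamma (m + 1)\<^sup>2 / Gamma (2 * m + 1)\<close> to such \<open>m\<close>.
\<close>

lemma inverse_central_gen_binomial: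
  "inverse (gen_binomial (2 * m) m) = (Gamma (m + 1))\<^sup>2 / Gamma (2 * m + 1)"
  by (simp add: gen_binomial_def power2_eq_square)

lemma inverse_central_gen_binomial_eq_0:
  assumes "2 * m + 1 \<in> \<int>\<^sub>\<le>\<^sub>0"
  shows "inverse (gen_binomial (2 * m) m) = 0"
  using assms by (simp add: gen_binomial_def Gamma_eq_zero_iff)

text \<open>Both halves of a two-sided series are required to converge separately.\<close>

definition bi_summable :: "(int \<Rightarrow> complex) \<Rightarrow> bool" where
  "bi_summable f \<longleftrightarrow> summable (\<lambda>n. f (int n)) \<and> summable (\<lambda>n. f (- int (Suc n)))"

definition bi_suminf :: "(int \<Rightarrow> complex) \<Rightarrow> complex" where
  "bi_suminf f = (\<Sum>n. f (int n)) + (\<Sum>n. f (- int (Suc n)))"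

text \<open>
  \<open>cyc_Li p x c\<close> is the cyclotomic Hurwitz zeta function
  \<open>Li\<^sub>p(x; c) = (\<Sum>n\<ge>1. x ^ n / (n + b) ^ p)\<close> with \<open>c = b + 1\<close>. The series need not converge
  absolutely for \<open>p = 1\<close>, so \<^const>\<open>suminf\<close> is used rather than \<^const>\<open>infsum\<close>.
\<close>

definition cyc_Li :: "nat \<Rightarrow> complex \<Rightarrow> complex \<Rightarrow> complex" where
  "cyc_Li p x c = (\<Sum>n. x ^ Suc n / (of_nat (Suc n) + (c - 1)) ^ p)"

text \<open>
  The combination \<open>Li\<^sub>1(x; 1 - a) - x * Li\<^sub>1(1/x; a)\<close>; for \<open>x = 1\<close> the two series diverge
  and only the series of the termwise differences makes sense.
\<close>

definition cyc_Li1_diff :: "complex \<Rightarrow> complex \<Rightarrow> complex" where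
  "cyc_Li1_diff x a =
     (if x = 1
      then (\<Sum>n. x ^ Suc n / (of_nat (Suc n) - a)
               - x powi (1 - int (Suc n)) / (of_nat (Suc n) + a - 1))
      else cyc_Li 1 x (1 - a) - x * cyc_Li 1 (inverse x) a)"

text \<open>
  The combination \<open>x * Li\<^sub>k\<^sub>+\<^sub>1(1/x; a) - (-1)\<^sup>k * Li\<^sub>k\<^sub>+\<^sub>1(x; 1 - a)\<close>; for \<open>k = 0\<close> it is the
  negative of the previous one and inherits its reading at \<open>x = 1\<close>.
\<close>

definition cyc_Li_comb :: "nat \<Rightarrow> complex \<Rightarrow> complex \<Rightarrow> complex" where
  "cyc_Li_comb k x a =
     (if k = 0 \<and> x = 1 then - cyc_Li1_diff x a
      else x * cyc_Li (k + 1) (inverse x) a - (-1) ^ k * cyc_Li (k + 1) x (1 - a))"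

text \<open>
  The exponential complete Bell polynomial \<open>Y\<^sub>n(x\<^sub>1, \<dots>, x\<^sub>n)\<close>, given by its generating function
  \<open>exp (\<Sum>k\<ge>1. x\<^sub>k * t ^ k / k!) = (\<Sum>n. Y\<^sub>n * t ^ n / n!)\<close>. The arguments are passed as
  a sequence whose entry at index \<open>0\<close> is ignored.
\<close>

definition bell_Y :: "nat \<Rightarrow> (nat \<Rightarrow> complex) \<Rightarrow> complex" where
  "bell_Y n x =
     fact n * fps_nth (fps_exp 1 oo Abs_fps (\<lambda>k. if k = 0 then 0 else x k / fact k)) n"

text \<open>The Riemann zeta function on the half-plane \<open>Re s > 1\<close>, where its Dirichlet series converges.\<close>

definition riemann_zeta :: "complex \<Rightarrow> complex" where
  "riemann_zeta s = (\<Sum>n. 1 / of_nat (Suc n) powr s)"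

definition coeff_C :: "nat \<Rightarrow> complex" where
  "coeff_C n =
     bell_Y n (\<lambda>k. if k = 1 then 0 else (-1) ^ k * fact (k - 1) * riemann_zeta (of_nat k))"

definition coeff_D :: "nat \<Rightarrow> complex" where
  "coeff_D n =
     bell_Y n (\<lambda>k. if k = 1 then 0 else (-1) ^ (k - 1) * fact (k - 1) * riemann_zeta (of_nat k))"

end

theory Submission
  imports Defs "HOL-Complex_Analysis.Complex_Analysis" "HOL-Real_Asymp.Real_Asymp"
begin

text \<open>
  By Legendre duplication, \<open>4\<^sup>s\<close> divided by the central binomial coefficient at \<open>s\<close> is
  \<open>s * B(s)\<close> with \<open>B(s) = Beta s (1/2)\<close>, which has the partial fraction expansion
  \<open>B(s) = (\<Sum>m. b\<^sub>m / (s + m))\<close> with \<open>b\<^sub>m\<close> the central binomial coefficient over \<open>4\<^sup>m\<close>. Dividing by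
  \<open>s\<^sup>Q\<close> (\<open>Q = q - 1\<close>) produces a polar part at \<open>0\<close>, whose coefficients are the Taylor coefficients of
  \<open>4\<^sup>s * Gamma(1 + s)\<^sup>2 / Gamma(1 + 2 * s)\<close> (a product of the four generating functions in the
  theorem), plus the sum of \<open>(-1)\<^sup>Q * b\<^sub>m / (m\<^sup>Q * (s + m))\<close> over \<open>m > 0\<close>. Now sum against \<open>x\<^sup>-\<^sup>n\<close> over
  \<open>s = n + a\<close> and \<open>-N \<le> n < N\<close>: up to boundary terms, the pole at \<open>-m\<close> contributes \<open>x\<^sup>m\<close> times what a
  simple pole at \<open>0\<close> contributes, so these poles produce the product of the
  \<open>Li\<^sub>1\<close> combination with the central binomial series.
\<close>

section \<open>Partial fractions of the Beta function at one half\<close>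

text \<open>The boundary terms are the obstacle. For a fixed pole they vanish as N grows, but not
  uniformly: when m is close to N the shifted window is one-sided and its sum may grow like log m.
  Exchanging the limit in N with the sum over the poles therefore requires coefficients summable
  against \<open>1 + harm m\<close>, which \<open>cbinom m / m ^ Q\<close> satisfies exactly for Q >
  0. Symmetric windows are also what gives a meaning to the case x = 1, where the two halves of a
  sum over a simple pole diverge separately. The first Bell argument is 0 because Euler's constant
  cancels: log Gamma(1 + t) has linear term - gamma t, so the squared factor Gamma(1 + t)^2
  contributes - 2 gamma t, and Gamma(1 + 2 t) in the denominator removes it. The polar coefficients
  of higher order are never found by summing series such as b_m / m^(Q+1); they are read off from
  the behaviour of the function at 0.\<close>

definition cbinom :: "nat \<Rightarrow> real" where
  "cbinom m = real ((2 * m) choose m) / 4 ^ m"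

lemma cbinom_0 [simp]: "cbinom 0 = 1"
  by (simp add: cbinom_def)

lemma cbinom_pos: "cbinom m > 0"
  by (simp add: cbinom_def)

lemma cbinom_Suc: "cbinom (Suc m) = cbinom m * (2 * real m + 1) / (2 * real m + 2)"
proof -
  have *: "real ((2 * n) choose n) = fact (2 * n) / (fact n * fact n)" for n
    by (subst binomial_fact) (auto simp: mult_2)
  have "2 * Suc m = Suc (Suc (2 * m))" by simp
  hence "fact (2 * Suc m) = (2 * real m + 2) * (2 * real m + 1) * fact (2 * m)"
    by (simp add: algebra_simps)
  thus ?thesis unfolding cbinom_def * by (simp add: divide_simps) (simp add: algebra_simps)
qed

text \<open>Wallis-type bound: with the weight 2 m + 1 the ratio of consecutive terms is
  (2m+1)(2m+3) / (2m+2)^2, which is below 1.\<close>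

lemma cbinom_square_le: "(cbinom m)\<^sup>2 * (2 * real m + 1) \<le> 1"
proof (induction m)
  case (Suc m)
  have "(cbinom (Suc m))\<^sup>2 * (2 * real (Suc m) + 1) =
      (cbinom m)\<^sup>2 * (2 * real m + 1) * ((2 * real m + 1) * (2 * real m + 3) / (2 * real m + 2)\<^sup>2)"
    by (simp add: cbinom_Suc power_divide power_mult_distrib) (simp add: power2_eq_square algebra_simps)
  also have "\<dots> \<le> 1 * 1"
  proof (intro mult_mono Suc)
    have "(2 * real m + 1) * (2 * real m + 3) \<le> (2 * real m + 2)\<^sup>2"
      by (simp add: power2_eq_square algebra_simps)
    thus "(2 * real m + 1) * (2 * real m + 3) / (2 * real m + 2)\<^sup>2 \<le> 1"
      by (simp add: divide_le_eq)
  qed auto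
  finally show ?case by simp
qed simp

lemma cbinom_le: "cbinom m \<le> 1 / sqrt (2 * real m + 1)"
proof -
  have "cbinom m * sqrt (2 * real m + 1) = sqrt ((cbinom m)\<^sup>2 * (2 * real m + 1))"
    using cbinom_pos[of m] by (simp add: real_sqrt_mult)
  also have "\<dots> \<le> 1" using cbinom_square_le[of m] by simp
  finally show ?thesis by (simp add: field_simps)
qed

lemma cbinom_bigo: "cbinom \<in> O(\<lambda>m. real m powr (-1/2))"
proof -
  have "cbinom \<in> O(\<lambda>m. 1 / sqrt (2 * real m + 1))"
    using cbinom_le cbinom_pos by (intro bigoI[of _ 1] always_eventually) (auto simp: less_imp_le)
  also have "(\<lambda>m::nat. 1 / sqrt (2 * real m + 1)) \<in> O(\<lambda>m. real m powr (-1/2))"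
    by real_asymp
  finally show ?thesis .
qed

lemma cbinom_tendsto_0: "cbinom \<longlonglongrightarrow> 0"
proof (rule tendsto_sandwich[OF _ _ tendsto_const])
  show "(\<lambda>m::nat. 1 / sqrt (2 * real m + 1)) \<longlonglongrightarrow> 0" by real_asymp
qed (auto intro!: always_eventually cbinom_le less_imp_le cbinom_pos)

section \<open>The partial fraction series and its recurrence\<close>

lemma norm_shift_ge:
  fixes s :: complex
  assumes "real m \<ge> 2 * norm s"
  shows "norm (s + of_nat m) \<ge> real m / 2"
  using norm_diff_ineq[of "of_nat m" s] assms by (simp add: add.commute)

lemma eventually_real_ge: "\<forall>\<^sub>F n in sequentially. real n \<ge> c"
  using filterlim_real_sequentially by (simp add: filterlim_at_top)

lemma norm_inverse_shift_bigo:
  "(\<lambda>m. norm (inverse (s + of_nat m :: complex))) \<in> O(\<lambda>m. real m powr (-1))"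
proof (rule bigoI[of _ 2])
  have "eventually (\<lambda>m. real m \<ge> 2 * norm s + 1) at_top" by (rule eventually_real_ge)
  thus "\<forall>\<^sub>F m in at_top. norm (norm (inverse (s + of_nat m))) \<le> 2 * norm (real m powr (-1))"
  proof eventually_elim
    case (elim m)
    hence "real m > 0" using norm_ge_zero[of s] by linarith
    moreover have "norm (s + of_nat m) \<ge> real m / 2"
      using elim by (intro norm_shift_ge) auto
    ultimately have le: "inverse (norm (s + of_nat m)) \<le> inverse (real m / 2)"
      by (intro le_imp_inverse_le) auto
    have eq: "2 * \<bar>real m powr (-1)\<bar> = inverse (real m / 2)"
      by (simp add: powr_minus_divide)
    show ?case unfolding real_norm_def norm_inverse abs_inverse abs_norm_cancel eq by (rule le)
  qed
qed

lemma summable_bigo_powr: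
  fixes f :: "nat \<Rightarrow> 'a :: banach"
  assumes "(\<lambda>n. norm (f n)) \<in> O(\<lambda>n. real n powr e)" "e < -1"
  shows "summable (\<lambda>n. norm (f n))"
proof (rule summable_comparison_test_bigo[OF _ assms(1)])
  have "summable (\<lambda>n. real n powr e)"
    unfolding summable_real_powr_iff by (rule assms(2))
  moreover have "norm (real n powr e) = real n powr e" for n
    by (simp only: real_norm_def abs_of_nonneg[OF powr_ge_zero])
  ultimately show "summable (\<lambda>n. norm (real n powr e))"
    by (simp only:)
qed

lemma summable_cbinom_over_shift:
  "summable (\<lambda>m. norm (of_real (cbinom m) / (s + of_nat m) :: complex))"
proof (rule summable_bigo_powr)
  have "(\<lambda>m. cbinom m * norm (inverse (s + of_nat m))) \<in> O(\<lambda>m. real m powr (-1/2) * real m powr (-1))"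
    by (intro landau_o.big.mult norm_inverse_shift_bigo cbinom_bigo)
  moreover have "real m powr (-1/2) * real m powr (-1) = real m powr (-3/2)" for m
    by (subst powr_add [symmetric]) simp
  moreover have "cbinom m * norm (inverse (s + of_nat m)) =
      norm (of_real (cbinom m) / (s + of_nat m) :: complex)" for m
    using cbinom_pos[of m] by (simp only: norm_of_real norm_mult divide_inverse real_norm_def abs_of_pos)
  ultimately show "(\<lambda>m. norm (of_real (cbinom m) / (s + of_nat m) :: complex)) \<in> O(\<lambda>m. real m powr (-3/2))"
    by (simp only:)
qed simp

text \<open>Formally the termwise integral of t^(s-1) (1-t)^(-1/2) over [0,1], since
  \<open>cbinom m\<close> is the Taylor coefficient of (1-t)^(-1/2).\<close>

definition cbinom_frac :: "complex \<Rightarrow> complex" where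
  "cbinom_frac s = (\<Sum>m. of_real (cbinom m) / (s + of_nat m))"

lemma cbinom_frac_sums: "(\<lambda>m. of_real (cbinom m) / (s + of_nat m)) sums cbinom_frac s"
  unfolding cbinom_frac_def by (intro summable_sums summable_norm_cancel[OF summable_cbinom_over_shift])

lemma nonpos_Ints_plus_of_nat:
  "s \<notin> \<int>\<^sub>\<le>\<^sub>0 \<Longrightarrow> s + of_nat m \<noteq> (0::complex)"
  by (metis add_eq_0_iff2 minus_of_nat_in_nonpos_Ints)

text \<open>The recurrence of Beta s (1/2), by telescoping: since (m+1) b_(m+1) = (m + 1/2) b_m, the
  termwise difference is the increment of m b_m / (s + m), which is 0 at m = 0 and tends to
  0.\<close>

lemma cbinom_frac_plus1:
  assumes "s \<notin> \<int>\<^sub>\<le>\<^sub>0"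
  shows "(s + 1/2) * cbinom_frac (s + 1) = s * cbinom_frac s"
proof -
  have nz: "s + of_nat m \<noteq> 0" for m using nonpos_Ints_plus_of_nat[OF assms] .
  have "(\<lambda>m. s * (of_real (cbinom m) / (s + of_nat m)) - (s + 1/2) * (of_real (cbinom m) / (s + 1 + of_nat m)))
          sums (s * cbinom_frac s - (s + 1/2) * cbinom_frac (s + 1))"
    by (intro sums_diff sums_mult cbinom_frac_sums)
  moreover have "(\<lambda>m. of_nat (Suc m) * of_real (cbinom (Suc m)) / (s + of_nat (Suc m)) -
          of_nat m * of_real (cbinom m) / (s + of_nat m)) sums (0 - of_nat 0 * of_real (cbinom 0) / (s + of_nat 0))"
  proof (rule telescope_sums)
    have "(\<lambda>m. of_real (cbinom m) * (of_nat m / (s + of_nat m))) \<longlonglongrightarrow> of_real 0 * (1 :: complex)"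
    proof (intro tendsto_mult tendsto_of_real cbinom_tendsto_0)
      have "(\<lambda>m. 1 - s * inverse (s + of_nat m)) \<longlonglongrightarrow> 1 - s * 0"
        by (intro tendsto_intros filterlim_compose[OF tendsto_inverse_0]
              tendsto_add_filterlim_at_infinity[OF tendsto_const] tendsto_of_nat)
      moreover have "1 - s * inverse (s + of_nat m) = of_nat m / (s + of_nat m)" for m
        using nz[of m] by (simp add: field_simps)
      ultimately show "(\<lambda>m. of_nat m / (s + of_nat m)) \<longlonglongrightarrow> 1" by simp
    qed
    thus "(\<lambda>m. of_nat m * of_real (cbinom m) / (s + of_nat m)) \<longlonglongrightarrow> 0" by (simp add: mult_ac)
  qed
  moreover have "s * (of_real (cbinom m) / (s + of_nat m)) - (s + 1/2) * (of_real (cbinom m) / (s + 1 + of_nat m))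
      = of_nat (Suc m) * of_real (cbinom (Suc m)) / (s + of_nat (Suc m)) - of_nat m * of_real (cbinom m) / (s + of_nat m)" for m
  proof -
    have 1: "of_nat (Suc m) * of_real (cbinom (Suc m)) = (of_nat m + 1/2) * complex_of_real (cbinom m)"
    proof -
      have "real (Suc m) * cbinom (Suc m) = (real m + 1/2) * cbinom m" by (simp add: cbinom_Suc field_simps)
      from arg_cong[OF this, of complex_of_real] show ?thesis by simp
    qed
    have 2: "s + 1 + of_nat m \<noteq> 0" using nz[of "Suc m"] by (simp add: add_ac)
    have 3: "s * c / (s + of_nat m) = c - of_nat m * c / (s + of_nat m)" for c
      using nz[of m] by (simp add: field_simps)
    have 4: "(s + 1/2) * c / (s + 1 + of_nat m) = c - (of_nat m + 1/2) * c / (s + 1 + of_nat m)" for c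
    proof -
      have "s + 1/2 = (s + 1 + of_nat m) - (of_nat m + 1/2)" by simp
      thus ?thesis using nonzero_mult_div_cancel_left[OF 2, of c]
        by (simp only: left_diff_distrib diff_divide_distrib)
    qed
    show ?thesis unfolding 1 using 3[of "of_real (cbinom m)"] 4[of "of_real (cbinom m)"]
      by (simp add: add_ac)
  qed
  ultimately have "s * cbinom_frac s - (s + 1/2) * cbinom_frac (s + 1) = 0"
    by (simp only: sums_unique2 mult_zero_left div_0 diff_zero of_nat_0)
  thus ?thesis by simp
qed

lemma cbinom_frac_1: "cbinom_frac 1 = 2"
proof -
  have "(\<lambda>m. 2 * cbinom m - 2 * cbinom (Suc m)) sums (2 * cbinom 0 - 2 * 0)"
    by (intro telescope_sums' tendsto_intros cbinom_tendsto_0)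
  hence "(\<lambda>m. complex_of_real (2 * cbinom m - 2 * cbinom (Suc m))) sums of_real 2"
    by (subst sums_of_real_iff) simp
  moreover have "complex_of_real (2 * cbinom m - 2 * cbinom (Suc m)) = of_real (cbinom m) / (1 + of_nat m)" for m
  proof -
    have "2 * cbinom m - 2 * cbinom (Suc m) = cbinom m / (1 + real m)" by (simp add: cbinom_Suc field_simps)
    from arg_cong[OF this, of complex_of_real] show ?thesis by simp
  qed
  ultimately show ?thesis using sums_unique2[OF cbinom_frac_sums[of 1]] by simp
qed

lemma Beta_half_plus1:
  assumes "s \<notin> \<int>\<^sub>\<le>\<^sub>0"
  shows "(s + 1/2) * Beta (s + 1) (1/2 :: complex) = s * Beta s (1/2)"
  using Beta_plus1_left[OF assms, of "1/2"] .

text \<open>Fixes what the recurrence leaves open: agreement at the positive integers anchors the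
  later comparison at infinity for general s.\<close>

lemma cbinom_frac_of_nat: "cbinom_frac (of_nat (Suc n)) = Beta (of_nat (Suc n)) (1/2)"
proof (induction n)
  case 0
  have "Beta 1 (1/2 :: complex) = 2"
  proof -
    have "(1 / 2 :: complex) \<notin> \<int>\<^sub>\<le>\<^sub>0"
      by (auto elim!: nonpos_Ints_cases simp: complex_eq_iff)
    from Gamma_plus1[OF this] have "of_real (sqrt pi) = 2 * Gamma (3/2 :: complex)"
      by (simp add: Gamma_one_half_complex mult.commute)
    moreover have "Gamma (3/2 :: complex) \<noteq> 0"
      using calculation by auto
    ultimately show ?thesis
      by (simp add: Beta_def Gamma_one_half_complex)
  qed
  thus ?case by (simp add: cbinom_frac_1)
next
  case (Suc n)
  let ?s = "of_nat (Suc n) :: complex"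
  have s: "?s \<notin> \<int>\<^sub>\<le>\<^sub>0" by (metis of_nat_in_nonpos_Ints_iff nat.simps(3))
  have "?s + 1/2 \<noteq> 0"
  proof
    assume "?s + 1/2 = 0"
    from arg_cong[OF this, of Re] show False by simp
  qed
  moreover have "(?s + 1/2) * cbinom_frac (?s + 1) = (?s + 1/2) * Beta (?s + 1) (1/2)"
    using cbinom_frac_plus1[OF s] Beta_half_plus1[OF s] Suc by simp
  ultimately show ?case by (simp add: add_ac)
qed

section \<open>Behaviour of the Beta function at infinity\<close>

lemma Re_pos_not_nonpos_Ints: "Re z > 0 \<Longrightarrow> z \<notin> \<int>\<^sub>\<le>\<^sub>0"
  by (auto simp: complex_eq_iff elim!: nonpos_Ints_cases)

text \<open>In the quotient of the Gauss products for 1 / Gamma at s and at s + 1/2 the factorials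
  cancel and the powers of n leave sqrt n, so the limit of the quotient is the asymptotic
  law.\<close>

lemma Beta_half_asymp_aux:
  assumes "Re s > 0"
  shows "(\<lambda>n. of_real (sqrt (real n)) * Beta (s + of_nat (Suc n)) (1/2)) \<longlonglongrightarrow> Gamma (1/2 :: complex)"
proof -
  define u where "u = s + 1/2"
  have s: "s \<notin> \<int>\<^sub>\<le>\<^sub>0" and u: "u \<notin> \<int>\<^sub>\<le>\<^sub>0"
    using assms by (auto simp: u_def intro!: Re_pos_not_nonpos_Ints)
  have nz: "Gamma s \<noteq> 0" "Gamma u \<noteq> 0" "rGamma s \<noteq> 0" "rGamma u \<noteq> 0"
    using s u by (auto simp: Gamma_eq_zero_iff rGamma_eq_zero_iff)
  have lim: "(\<lambda>n. (rGamma_series s n * Gamma s) / (rGamma_series u n * Gamma u) * Gamma (1/2))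
     \<longlonglongrightarrow> (rGamma s * Gamma s) / (rGamma u * Gamma u) * Gamma (1/2 :: complex)"
    using nz by (intro tendsto_intros rGamma_series_LIMSEQ) auto
  have "(rGamma s * Gamma s) / (rGamma u * Gamma u) = 1"
    using nz by (simp add: rGamma_inverse_Gamma)
  with lim have lim: "(\<lambda>n. (rGamma_series s n * Gamma s) / (rGamma_series u n * Gamma u) * Gamma (1/2))
     \<longlonglongrightarrow> Gamma (1/2 :: complex)" by simp
  have "eventually (\<lambda>n. (rGamma_series s n * Gamma s) / (rGamma_series u n * Gamma u) * Gamma (1/2)
     = of_real (sqrt (real n)) * Beta (s + of_nat (Suc n)) (1/2)) sequentially"
    using eventually_gt_at_top[of 0]
  proof eventually_elim
    case (elim n)
    have p1: "pochhammer s (Suc n) = Gamma (s + of_nat (Suc n)) / Gamma s"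
      and p2: "pochhammer u (Suc n) = Gamma (u + of_nat (Suc n)) / Gamma u"
      using pochhammer_Gamma[OF s] pochhammer_Gamma[OF u] by simp_all
    have "exp (u * of_real (ln (real n))) = exp (s * of_real (ln (real n))) * of_real (exp (ln (real n) / 2))"
      by (simp add: u_def algebra_simps exp_add flip: exp_of_real)
    also have "exp (ln (real n) / 2) = sqrt (real n)"
      using elim by (simp add: powr_half_sqrt [symmetric] powr_def)
    finally have e: "exp (u * of_real (ln (real n))) = exp (s * of_real (ln (real n))) * of_real (sqrt (real n))" .
    have "Re (u + of_nat (Suc n)) > 0"
      using assms by (simp add: u_def)
    hence "Gamma (u + of_nat (Suc n)) \<noteq> 0"
      by (simp only: Gamma_eq_zero_iff Re_pos_not_nonpos_Ints not_False_eq_True)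
    moreover have "Beta (s + of_nat (Suc n)) (1/2) = Gamma (s + of_nat (Suc n)) * Gamma (1/2) / Gamma (u + of_nat (Suc n))"
      by (simp add: Beta_def u_def add_ac)
    ultimately show ?case using nz elim
      unfolding rGamma_series_def Suc_eq_plus1 [symmetric] p1 p2 e by (simp add: divide_simps)
  qed
  from Lim_transform_eventually[OF lim this] show ?thesis .
qed

theorem Beta_half_asymp:
  "(\<lambda>n. of_real (sqrt (real n)) * Beta (s + of_nat n) (1/2)) \<longlonglongrightarrow> Gamma (1/2 :: complex)"
proof -
  \<comment> \<open>Shifting by k reaches the right half-plane, and sqrt ((n+k+1) / n) -> 1 absorbs
    the shift.\<close>
  obtain k :: nat where "real k > - Re s" using reals_Archimedean2 by blast
  hence k: "Re (s + of_nat k) > 0" by simp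
  have "(\<lambda>n. of_real (sqrt (real (n + Suc k)) / sqrt (real n)) *
      (of_real (sqrt (real n)) * Beta (s + of_nat k + of_nat (Suc n)) (1/2))) \<longlonglongrightarrow> of_real 1 * Gamma (1/2 :: complex)"
    by (intro tendsto_mult tendsto_of_real Beta_half_asymp_aux k) real_asymp
  hence "(\<lambda>n. of_real (sqrt (real (n + Suc k)) / sqrt (real n)) *
      (of_real (sqrt (real n)) * Beta (s + of_nat k + of_nat (Suc n)) (1/2))) \<longlonglongrightarrow> Gamma (1/2 :: complex)"
    by simp
  moreover have "eventually (\<lambda>n. of_real (sqrt (real (n + Suc k)) / sqrt (real n)) *
      (of_real (sqrt (real n)) * Beta (s + of_nat k + of_nat (Suc n)) (1/2))
     = of_real (sqrt (real (n + Suc k))) * Beta (s + of_nat (n + Suc k)) (1/2 :: complex)) sequentially"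
    using eventually_gt_at_top[of 0] by eventually_elim (simp add: add_ac)
  ultimately have "(\<lambda>n. of_real (sqrt (real (n + Suc k))) * Beta (s + of_nat (n + Suc k)) (1/2 :: complex))
      \<longlonglongrightarrow> Gamma (1/2)"
    by (rule Lim_transform_eventually)
  thus ?thesis by (rule LIMSEQ_offset)
qed

lemma norm_Beta_half_bigo:
  "(\<lambda>n. norm (Beta (s + of_nat n) (1/2 :: complex))) \<in> O(\<lambda>n. real n powr (-1/2))"
proof -
  have "Bseq (\<lambda>n. of_real (sqrt (real n)) * Beta (s + of_nat n) (1/2 :: complex))"
    by (rule convergent_imp_Bseq[OF convergentI[OF Beta_half_asymp]])
  then obtain C where C: "\<And>n. norm (of_real (sqrt (real n)) * Beta (s + of_nat n) (1/2 :: complex)) \<le> C"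
    by (rule BseqE) blast
  have "norm (Beta (s + of_nat n) (1/2 :: complex)) \<le> C * real n powr (-1/2)" if "n > 0" for n
    using C[of n] that
    by (simp add: norm_mult powr_minus_divide powr_half_sqrt pos_le_divide_eq mult.commute)
  thus ?thesis
    by (intro bigoI[of _ C] eventually_mono[OF eventually_gt_at_top[of 0]]) simp
qed

text \<open>The terms differ by - s b_m / ((s+n+m)(n+m)), and |s+n+m| >= n/2 uniformly in m. The
  relative error O(1/n) makes the shift by s invisible in the limit of sqrt n times the sum.\<close>

lemma norm_cbinom_frac_diff_le:
  assumes "real n \<ge> 2 * norm s" "n > 0"
  shows "norm (cbinom_frac (s + of_nat n) - cbinom_frac (of_nat n)) \<le> 2 * norm s / real n * norm (cbinom_frac (of_nat n))"
proof -
  have sums: "(\<lambda>m. cbinom m / (real n + real m)) sums Re (cbinom_frac (of_nat n))"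
  proof -
    have "complex_of_real (cbinom m) / (of_nat n + of_nat m) = of_real (cbinom m / (real n + real m))" for m
      by simp
    with sums_Re[OF cbinom_frac_sums[of "of_nat n"]] show ?thesis by (simp only: Re_complex_of_real)
  qed
  have "(\<lambda>m. of_real (cbinom m) / (s + of_nat n + of_nat m) - of_real (cbinom m) / (of_nat n + of_nat m)) sums
      (cbinom_frac (s + of_nat n) - cbinom_frac (of_nat n))"
    by (intro sums_diff cbinom_frac_sums)
  moreover have "(\<lambda>m. 2 * norm s / real n * (cbinom m / (real n + real m))) sums (2 * norm s / real n * Re (cbinom_frac (of_nat n)))"
    by (intro sums_mult sums)
  moreover have "norm (of_real (cbinom m) / (s + of_nat n + of_nat m) - of_real (cbinom m) / (of_nat n + of_nat m))
      \<le> 2 * norm s / real n * (cbinom m / (real n + real m))" for m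
  proof -
    have "norm (s + of_nat (n + m)) \<ge> real (n + m) / 2"
      using assms by (intro norm_shift_ge) auto
    hence ge: "norm (s + of_nat n + of_nat m) \<ge> real n / 2" by (simp add: add_ac)
    hence nz: "s + of_nat n + of_nat m \<noteq> 0" using assms by auto
    have nz': "complex_of_nat n + of_nat m \<noteq> 0"
      using assms(2) by (metis of_nat_add of_nat_eq_0_iff add_eq_0_iff_both_eq_0 less_numeral_extra(3))
    have "of_real (cbinom m) / (s + of_nat n + of_nat m) - of_real (cbinom m) / (of_nat n + of_nat m) =
       - (s * of_real (cbinom m)) / ((s + of_nat n + of_nat m) * (of_nat n + of_nat m))"
      using nz nz' by (simp add: field_simps)
    hence "norm (of_real (cbinom m) / (s + of_nat n + of_nat m) - of_real (cbinom m) / (of_nat n + of_nat m)) =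
       norm s * cbinom m / (norm (s + of_nat n + of_nat m) * norm (complex_of_nat n + of_nat m))"
      using cbinom_pos[of m] by (simp add: norm_divide norm_mult)
    also have "norm (complex_of_nat n + of_nat m) = real n + real m"
      by (metis norm_of_nat of_nat_add)
    also have "norm s * cbinom m / (norm (s + of_nat n + of_nat m) * (real n + real m)) \<le>
        norm s * cbinom m / (real n / 2 * (real n + real m))"
      using ge assms cbinom_pos[of m] by (intro divide_left_mono mult_right_mono mult_pos_pos mult_nonneg_nonneg) auto
    finally show ?thesis by (simp add: field_simps)
  qed
  ultimately have "norm (cbinom_frac (s + of_nat n) - cbinom_frac (of_nat n)) \<le> 2 * norm s / real n * Re (cbinom_frac (of_nat n))"
    by (rule norm_sums_le)
  also have "\<dots> \<le> 2 * norm s / real n * norm (cbinom_frac (of_nat n))"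
    by (intro mult_left_mono complex_Re_le_cmod) auto
  finally show ?thesis .
qed

theorem Beta_half_partial_fractions:
  fixes s :: complex
  assumes s: "s \<notin> \<int>\<^sub>\<le>\<^sub>0"
  shows "(\<lambda>m. of_real (cbinom m) / (s + of_nat m)) sums Beta s (1/2)"
proof -
  define D where "D s = Beta s (1/2) - cbinom_frac s" for s :: complex
  \<comment> \<open>Both functions satisfy the recurrence of the Beta function, so comparing them at infinity suffices.\<close>
  have cross: "D s * Beta (s + of_nat n) (1/2) = D (s + of_nat n) * Beta s (1/2)" for n
    using s
  proof (induction n arbitrary: s)
    case (Suc n)
    have nz: "s \<noteq> 0" using Suc.prems by auto
    have s1: "s + 1 \<notin> \<int>\<^sub>\<le>\<^sub>0"
      using Suc.prems plus_one_in_nonpos_Ints_imp by blast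
    have B: "Beta s (1/2) = (s + 1/2) * Beta (s + 1) (1/2) / s"
      using Beta_half_plus1[OF Suc.prems] nz by (simp add: field_simps)
    have D: "D s = (s + 1/2) * D (s + 1) / s"
      using Beta_half_plus1[OF Suc.prems] cbinom_frac_plus1[OF Suc.prems] nz
      by (simp add: D_def right_diff_distrib field_simps)
    have e: "s + of_nat (Suc n) = s + 1 + of_nat n" by (simp add: add_ac)
    show ?case unfolding e B D using Suc.IH[OF s1] by simp
  qed simp
  \<comment> \<open>\<open>D\<close> vanishes at positive integers, so \<open>D (s + n)\<close> is
    the change from n to s + n of the Beta function minus that of the series; each change is
    negligible against 1 / sqrt n.\<close>
  have "(\<lambda>n. of_real (sqrt (real n)) * D (s + of_nat n)) \<longlonglongrightarrow> 0"
  proof -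
    let ?r = "\<lambda>n. complex_of_real (sqrt (real n))"
    have "(\<lambda>n. ?r n * Beta (s + of_nat n) (1/2) - ?r n * Beta (0 + of_nat n) (1/2)) \<longlonglongrightarrow> Gamma (1/2) - Gamma (1/2)"
      by (intro tendsto_diff Beta_half_asymp)
    moreover have "(\<lambda>n. ?r n * (cbinom_frac (s + of_nat n) - cbinom_frac (of_nat n))) \<longlonglongrightarrow> 0"
    proof (rule Lim_null_comparison)
      show "\<forall>\<^sub>F n in sequentially. norm (?r n * (cbinom_frac (s + of_nat n) - cbinom_frac (of_nat n)))
          \<le> 2 * norm s / real n * norm (?r n * Beta (0 + of_nat n) (1/2))"
      proof -
        have "\<forall>\<^sub>F n in sequentially. real n \<ge> 2 * norm s + 1" by (rule eventually_real_ge)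
        thus ?thesis
        proof eventually_elim
          case (elim n)
          hence n: "real n \<ge> 2 * norm s" "n > 0"
            using norm_ge_zero[of s] by (auto intro: Nat.gr0I simp del: norm_ge_zero)
          have "cbinom_frac (of_nat n) = Beta (of_nat n) (1/2)"
            using cbinom_frac_of_nat[of "n - 1"] n by simp
          with norm_cbinom_frac_diff_le[OF n]
          have "sqrt (real n) * norm (cbinom_frac (s + of_nat n) - cbinom_frac (of_nat n)) \<le>
              sqrt (real n) * (2 * norm s / real n * norm (Beta (of_nat n) (1/2 :: complex)))"
            by (intro mult_left_mono) auto
          thus ?case by (simp add: norm_mult mult_ac)
        qed
      qed
      have "(\<lambda>n. 2 * norm s / real n * norm (?r n * Beta (0 + of_nat n) (1/2))) \<longlonglongrightarrow> 0 * norm (Gamma (1/2 :: complex))"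
        by (intro tendsto_mult tendsto_norm Beta_half_asymp lim_const_over_n)
      thus "(\<lambda>n. 2 * norm s / real n * norm (?r n * Beta (0 + of_nat n) (1/2))) \<longlonglongrightarrow> 0" by simp
    qed
    ultimately have "(\<lambda>n. (?r n * Beta (s + of_nat n) (1/2) - ?r n * Beta (0 + of_nat n) (1/2))
        - ?r n * (cbinom_frac (s + of_nat n) - cbinom_frac (of_nat n))) \<longlonglongrightarrow> (Gamma (1/2) - Gamma (1/2)) - 0"
      by (rule tendsto_diff)
    moreover have "\<forall>\<^sub>F n in sequentially. (?r n * Beta (s + of_nat n) (1/2) - ?r n * Beta (0 + of_nat n) (1/2))
        - ?r n * (cbinom_frac (s + of_nat n) - cbinom_frac (of_nat n)) = ?r n * D (s + of_nat n)"
      using eventually_gt_at_top[of 0]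
    proof eventually_elim
      case (elim n)
      have "cbinom_frac (of_nat n) = Beta (of_nat n) (1/2)"
        using cbinom_frac_of_nat[of "n - 1"] elim by simp
      thus ?case by (simp add: D_def algebra_simps)
    qed
    ultimately have "(\<lambda>n. ?r n * D (s + of_nat n)) \<longlonglongrightarrow> (Gamma (1/2) - Gamma (1/2)) - 0"
      by (rule Lim_transform_eventually)
    thus ?thesis by simp
  qed
  \<comment> \<open>The products in \<open>cross\<close> avoid dividing by Beta s (1/2), which is 0
    for s = -1/2, -3/2, and so on. Both sides of \<open>cross\<close>, scaled by sqrt n, have
    limits: 0 on one side, \<open>D s * Gamma (1/2)\<close> on the other.\<close>
  hence "(\<lambda>n. of_real (sqrt (real n)) * D (s + of_nat n) * Beta s (1/2)) \<longlonglongrightarrow> 0 * Beta s (1/2)"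
    by (intro tendsto_mult tendsto_const)
  hence "(\<lambda>n. D s * (of_real (sqrt (real n)) * Beta (s + of_nat n) (1/2))) \<longlonglongrightarrow> 0"
    by (simp only: mult.left_commute[of "D s"] cross mult.assoc mult_zero_left)
  moreover have "(\<lambda>n. D s * (of_real (sqrt (real n)) * Beta (s + of_nat n) (1/2))) \<longlonglongrightarrow> D s * Gamma (1/2)"
    by (intro tendsto_mult tendsto_const Beta_half_asymp)
  ultimately have "D s * Gamma (1/2) = 0" using LIMSEQ_unique by blast
  hence "D s = 0" by (simp add: Gamma_one_half_complex)
  thus ?thesis using cbinom_frac_sums[of s] by (simp add: D_def)
qed

section \<open>The Taylor series of the reciprocal central binomial coefficient\<close>

lemma Ln_4: "Ln 4 = 2 * complex_of_real (ln 2)"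
proof -
  have "Ln (complex_of_real 4) = of_real (ln 4)" by (rule Ln_of_real) simp
  moreover have "ln (4::real) = 2 * ln 2"
    using ln_realpow[of 2 2] by simp
  ultimately show ?thesis by simp
qed

lemma four_powr: "4 powr (s :: complex) = exp (2 * of_real (ln 2) * s)"
  by (simp add: powr_def Ln_4 mult_ac)

lemma four_powr_over_gen_binomial:
  assumes s: "s \<notin> \<int>"
  shows "4 powr s / gen_binomial (2 * s) s = s * Beta s (1/2)"
\<comment> \<open>The duplication formula excludes this case. As s is not an integer, it is then a
  negative half-integer; 2 s + 1 and s + 1/2 are both poles of Gamma, so both sides are 0, the left
  one by the convention on the reciprocal binomial.\<close>
proof (cases "2 * s \<in> \<int>\<^sub>\<le>\<^sub>0")
  case True
  then obtain n where n: "2 * s = - of_nat n" by (rule nonpos_Ints_cases')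
  have "odd n"
  proof
    assume "even n"
    then obtain k where "n = 2 * k" by blast
    hence "s = - of_nat k" using n by simp
    thus False using s by (simp add: Ints_minus)
  qed
  then obtain k where k: "n = 2 * k + 1" by (rule oddE)
  have 1: "2 * s + 1 = - of_nat (2 * k)" and 2: "s + 1/2 = - of_nat k"
  proof -
    show "2 * s + 1 = - of_nat (2 * k)" using n k by simp
    hence "2 * (s + 1/2) = 2 * (- of_nat k)" unfolding distrib_left by simp
    thus "s + 1/2 = - of_nat k" by (subst (asm) mult_cancel_left) simp
  qed
  have "Gamma (2 * s + 1) = 0" "Gamma (s + 1/2) = 0"
    unfolding 1 2 Gamma_eq_zero_iff by (intro minus_of_nat_in_nonpos_Ints)+
  thus ?thesis by (simp add: gen_binomial_def Beta_def)
next
  case False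
  have s': "s \<notin> \<int>\<^sub>\<le>\<^sub>0" using s by (auto elim!: nonpos_Ints_cases)
  have s2: "s + 1/2 \<notin> \<int>\<^sub>\<le>\<^sub>0"
  proof
    assume "s + 1/2 \<in> \<int>\<^sub>\<le>\<^sub>0"
    then obtain n where "s + 1/2 = - of_nat n" by (rule nonpos_Ints_cases')
    note n = this
    have "2 * s = 2 * (s + 1/2) - 1" by (simp add: distrib_left)
    also have "\<dots> = - of_nat (2 * n + 1)" unfolding n by simp
    finally have "2 * s = - of_nat (2 * n + 1)" .
    thus False using False by (metis minus_of_nat_in_nonpos_Ints)
  qed
  define E where "E = exp (2 * complex_of_real (ln 2) * s)"
  have E: "exp ((1 - 2 * s) * of_real (ln 2)) = 2 / E"
  proof -
    have "(1 - 2 * s) * complex_of_real (ln 2) = of_real (ln 2) - 2 * of_real (ln 2) * s"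
      by (simp add: algebra_simps)
    thus ?thesis unfolding E_def by (simp add: exp_diff exp_of_real)
  qed
  have G1: "Gamma (s + 1) = s * Gamma s" and G2: "Gamma (2 * s + 1) = 2 * s * Gamma (2 * s)"
    using Gamma_plus1[OF s'] Gamma_plus1[OF False] by simp_all
  have dup: "Gamma s * Gamma (s + 1/2) = 2 / E * of_real (sqrt pi) * Gamma (2 * s)"
    using Gamma_legendre_duplication[OF s' s2] E by simp
  have nz: "s \<noteq> 0" "Gamma s \<noteq> 0" "Gamma (s + 1/2) \<noteq> 0" "Gamma (2 * s) \<noteq> 0" "E \<noteq> 0"
    using s s' s2 False by (auto simp: Gamma_eq_zero_iff E_def)
  have "2 * of_real (sqrt pi) * Gamma (2 * s) = E * (Gamma s * Gamma (s + 1/2))"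
    using nz unfolding dup by simp
  hence "of_real (sqrt pi) = E * (Gamma s * Gamma (s + 1/2)) / (2 * Gamma (2 * s))"
    using nz by (simp add: field_simps)
  moreover have "4 powr s / gen_binomial (2 * s) s = E * (s * Gamma s)\<^sup>2 / (2 * s * Gamma (2 * s))"
    by (simp add: gen_binomial_def four_powr E_def G1 G2 power2_eq_square)
  moreover have "Beta s (1/2) = Gamma s * of_real (sqrt pi) / Gamma (s + 1/2)"
    by (simp add: Beta_def Gamma_one_half_complex)
  ultimately show ?thesis using nz by (simp add: power2_eq_square)
qed

section \<open>Generating functions of C, D and the reciprocal central binomial\<close>

definition log_Gamma_fps :: "complex fps" where
  "log_Gamma_fps = Abs_fps (\<lambda>k. if k < 2 then 0 else (-1) ^ k * riemann_zeta (of_nat k) / of_nat k)"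

lemma riemann_zeta_of_nat:
  assumes "n > 0"
  shows "riemann_zeta (of_nat n) = (\<Sum>k. inverse ((1 + of_nat k) ^ n))"
proof -
  have "1 / of_nat (Suc k) powr of_nat n = inverse ((1 + of_nat k) ^ n :: complex)" for k
    using assms by (subst powr_nat') (auto simp: inverse_eq_divide)
  thus ?thesis unfolding riemann_zeta_def by simp
qed

text \<open>For k >= 2 the k-th derivative of log Gamma at 1 is a Polygamma value, that is, a signed
  factorial times zeta(k). The added linear term cancels the derivative - gamma at 1.\<close>

lemma has_fps_expansion_log_Gamma:
  "(\<lambda>t. ln_Gamma (1 + t) + euler_mascheroni * t) has_fps_expansion log_Gamma_fps"
proof -
  have 1: "ln_Gamma 1 = (0 :: complex)"
    using ln_Gamma_complex_of_real[of 1] ln_Gamma_real_pos[of 1] by simp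
  have notin: "(1 :: complex) \<notin> \<real>\<^sub>\<le>\<^sub>0" by simp
  have "(\<lambda>t. ln_Gamma (1 + t) + euler_mascheroni * t) has_fps_expansion
      fps_expansion ln_Gamma (1 :: complex) + fps_const euler_mascheroni * fps_X"
    by (intro has_fps_expansion_add has_fps_expansion_cmult_left has_fps_expansion_fps_X
          analytic_at_imp_has_fps_expansion analytic_ln_Gamma) simp
  also have "fps_expansion ln_Gamma (1 :: complex) + fps_const euler_mascheroni * fps_X = log_Gamma_fps"
  proof (rule fps_ext)
    fix k :: nat
    consider "k = 0" | "k = 1" | n where "k = Suc (Suc n)"
      by (metis One_nat_def not0_implies_Suc)
    thus "fps_nth (fps_expansion ln_Gamma (1 :: complex) + fps_const euler_mascheroni * fps_X) k = fps_nth log_Gamma_fps k"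
    proof cases
      case 3
      have "Polygamma (Suc n) (1 :: complex) = (-1) ^ k * fact (Suc n) * riemann_zeta (of_nat k)"
        using riemann_zeta_of_nat[of k] by (simp add: Polygamma_def 3)
      moreover have "fps_nth (fps_expansion ln_Gamma (1 :: complex)) k = Polygamma (Suc n) 1 / fact k"
        unfolding fps_expansion_def using higher_deriv_ln_Gamma_complex[OF notin, of k] 3
        by (simp del: funpow.simps)
      moreover have "(fact k :: complex) = of_nat k * fact (Suc n)" by (simp add: 3)
      ultimately show ?thesis by (simp add: log_Gamma_fps_def 3 del: fact_Suc of_nat_Suc)
    qed (simp_all add: log_Gamma_fps_def fps_expansion_def higher_deriv_ln_Gamma_complex[OF notin, of 0]
           higher_deriv_ln_Gamma_complex[OF notin, of 1, simplified] 1)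
  qed
  finally show ?thesis .
qed

text \<open>Dividing (k-1)! by k! leaves 1 / k, so the two exponential generating functions are
  those of e^(gamma t) Gamma(1 + t) and of its reciprocal.\<close>

lemma coeff_C_eq: "coeff_C n = fact n * fps_nth (fps_exp 1 oo log_Gamma_fps) n"
  and coeff_D_eq: "coeff_D n = fact n * fps_nth (fps_exp 1 oo (- log_Gamma_fps)) n"
proof -
  have "Abs_fps (\<lambda>k. if k = 0 then 0 else (if k = 1 then 0 else (-1) ^ k * fact (k - 1) * riemann_zeta (of_nat k)) / fact k)
      = log_Gamma_fps"
    apply (rule fps_ext) subgoal for k by (cases k) (auto simp: log_Gamma_fps_def) done
  thus "coeff_C n = fact n * fps_nth (fps_exp 1 oo log_Gamma_fps) n"
    unfolding coeff_C_def bell_Y_def by (simp only:)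
  have "Abs_fps (\<lambda>k. if k = 0 then 0 else (if k = 1 then 0 else (-1) ^ (k - 1) * fact (k - 1) * riemann_zeta (of_nat k)) / fact k)
      = - log_Gamma_fps"
    apply (rule fps_ext) subgoal for k by (cases k) (auto simp: log_Gamma_fps_def) done
  thus "coeff_D n = fact n * fps_nth (fps_exp 1 oo (- log_Gamma_fps)) n"
    unfolding coeff_D_def bell_Y_def by (simp only:)
qed

text \<open>The factors stay separate to match the summation indices: two copies of C, then D
  dilated by 2, which yields 2^k3, and 4^t, which yields (2 log 2)^k4 / k4!.\<close>

definition central_gf_fps :: "complex fps" where
  "central_gf_fps = (fps_exp 1 oo log_Gamma_fps) * (fps_exp 1 oo log_Gamma_fps) *
     ((fps_exp 1 oo (- log_Gamma_fps)) oo (fps_const 2 * fps_X)) * fps_exp (2 * of_real (ln 2))"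

lemma has_fps_expansion_central_gf:
  "(\<lambda>t. Gamma (1 + t) * Gamma (1 + t) * inverse (Gamma (1 + 2 * t)) * 4 powr t) has_fps_expansion central_gf_fps"
proof -
  define L where "L = (\<lambda>t :: complex. ln_Gamma (1 + t) + euler_mascheroni * t)"
  have L: "L has_fps_expansion log_Gamma_fps"
    unfolding L_def by (rule has_fps_expansion_log_Gamma)
  have nth0: "fps_nth log_Gamma_fps 0 = 0" by (simp add: log_Gamma_fps_def)
  have C: "(exp \<circ> L) has_fps_expansion (fps_exp 1 oo log_Gamma_fps)"
    by (intro has_fps_expansion_compose has_fps_expansion_exp1 L nth0)
  have "(exp \<circ> (\<lambda>t. - L t)) has_fps_expansion (fps_exp 1 oo (- log_Gamma_fps))"
    using nth0 by (intro has_fps_expansion_compose has_fps_expansion_exp1 L has_fps_expansion_minus) simp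
  hence D: "((exp \<circ> (\<lambda>t. - L t)) \<circ> (\<lambda>t. 2 * t)) has_fps_expansion
      ((fps_exp 1 oo (- log_Gamma_fps)) oo (fps_const 2 * fps_X))"
    by (rule has_fps_expansion_compose) (auto intro!: has_fps_expansion_cmult_left has_fps_expansion_fps_X)
  have "(\<lambda>t. (exp \<circ> L) t * (exp \<circ> L) t * ((exp \<circ> (\<lambda>t. - L t)) \<circ> (\<lambda>t. 2 * t)) t * exp (2 * of_real (ln 2) * t))
      has_fps_expansion central_gf_fps"
    unfolding central_gf_fps_def by (intro has_fps_expansion_mult C D has_fps_expansion_exp)
  moreover have ev: "\<forall>\<^sub>F t in nhds 0. (exp \<circ> L) t * (exp \<circ> L) t * ((exp \<circ> (\<lambda>t. - L t)) \<circ> (\<lambda>t. 2 * t)) t * exp (2 * of_real (ln 2) * t)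
     = Gamma (1 + t) * Gamma (1 + t) * inverse (Gamma (1 + 2 * t)) * 4 powr t"
  proof -
    have "\<forall>\<^sub>F t in nhds (0::complex). t \<in> ball 0 (1/2)"
      by (rule eventually_nhds_in_open) auto
    thus ?thesis
    proof eventually_elim
      case (elim t)
      hence "\<bar>Re t\<bar> < 1/2" using abs_Re_le_cmod[of t] by simp
      hence n: "1 + t \<notin> \<int>\<^sub>\<le>\<^sub>0" "1 + 2 * t \<notin> \<int>\<^sub>\<le>\<^sub>0"
        by (auto intro!: Re_pos_not_nonpos_Ints)
      have G1: "exp (ln_Gamma (1 + t)) = Gamma (1 + t)" and G2: "exp (ln_Gamma (1 + 2 * t)) = Gamma (1 + 2 * t)"
        using n by (simp_all add: Gamma_complex_altdef)
      \<comment> \<open>Euler's constant cancels here: twice gamma t against gamma times 2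
        t.\<close>
      have e: "exp (L t) * exp (L t) * exp (- L (2 * t)) =
          exp (ln_Gamma (1 + t)) * exp (ln_Gamma (1 + t)) * exp (- ln_Gamma (1 + 2 * t))"
        unfolding exp_add [symmetric] L_def by (simp add: algebra_simps)
      show ?case unfolding o_def e unfolding exp_minus G1 G2 four_powr ..
    qed
  qed
  ultimately show ?thesis
    by (simp only: has_fps_expansion_cong[OF ev refl])
qed

text \<open>The neighbourhood is punctured because at t = 0 the right-hand side is 0, while the
  series has constant term 1.\<close>

lemma central_gf_eventually:
  "\<forall>\<^sub>F t in at 0. eval_fps central_gf_fps t = t * Beta t (1/2)"
proof -
  have "\<forall>\<^sub>F t in nhds 0. eval_fps central_gf_fps t = Gamma (1 + t) * Gamma (1 + t) * inverse (Gamma (1 + 2 * t)) * 4 powr t"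
    using has_fps_expansion_central_gf by (simp add: has_fps_expansion_def)
  hence "\<forall>\<^sub>F t in at 0. eval_fps central_gf_fps t = Gamma (1 + t) * Gamma (1 + t) * inverse (Gamma (1 + 2 * t)) * 4 powr t"
    by (simp add: eventually_at_filter eventually_mono)
  moreover have "\<forall>\<^sub>F t in at (0::complex). t \<in> ball 0 1 - {0}"
    by (rule eventually_at_in_open) auto
  ultimately show ?thesis
  proof eventually_elim
    case (elim t)
    have "t \<notin> \<int>"
    proof
      assume "t \<in> \<int>"
      then obtain k where "t = of_int k" by (rule Ints_cases)
      with elim(2) show False by auto
    qed
    note four = four_powr_over_gen_binomial[OF this]
    have gen: "gen_binomial (2 * t) t = Gamma (1 + 2 * t) / (Gamma (1 + t) * Gamma (1 + t))"
      by (simp add: gen_binomial_def add.commute)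
    show ?case unfolding four [symmetric] gen elim(1) by (simp add: inverse_eq_divide)
  qed
qed

section \<open>The poles away from 0\<close>

lemma harm_bigo: "(\<lambda>m. 1 + harm m :: real) \<in> O(\<lambda>m. real m powr (1/4))"
proof -
  have "Bseq (\<lambda>n. harm n - ln (real n) :: real)"
    using euler_mascheroni_convergent by (rule convergent_imp_Bseq)
  then obtain C where C: "\<And>n. norm (harm n - ln (real n) :: real) \<le> C"
    by (rule BseqE) blast
  have 1: "(\<lambda>n. harm n - ln (real n) :: real) \<in> O(\<lambda>_. 1)"
    using C by (intro bigoI[of _ C] always_eventually) auto
  have "(\<lambda>n. (harm n - ln (real n)) + (ln (real n) + 1)) \<in> O(\<lambda>m. real m powr (1/4))"
  proof (rule sum_in_bigo(1))
    show "(\<lambda>n. harm n - ln (real n) :: real) \<in> O(\<lambda>m. real m powr (1/4))"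
      by (rule landau_o.big.trans[OF 1]) real_asymp
  qed real_asymp+
  thus ?thesis by (simp add: add.commute)
qed

text \<open>The residue of Beta s (1/2) / s^Q at -m for m > 0. Entry 0 is cleared because the pole
  at 0 has order Q + 1 and is expanded separately.\<close>

definition tail_coeff :: "nat \<Rightarrow> nat \<Rightarrow> complex" where
  "tail_coeff Q m = (if m = 0 then 0 else (-1) ^ Q * of_real (cbinom m) / of_nat m ^ Q)"

lemma norm_tail_coeff_le_cbinom: "norm (tail_coeff Q m) \<le> cbinom m"
proof (cases "m = 0")
  case False
  hence "real m ^ Q \<ge> 1" by (intro one_le_power) simp
  hence "cbinom m / real m ^ Q \<le> cbinom m" using cbinom_pos[of m] by (simp add: divide_le_eq)
  thus ?thesis using cbinom_pos[of m] False by (simp add: tail_coeff_def norm_divide norm_mult norm_power)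
qed (simp add: tail_coeff_def)

lemma norm_tail_coeff_le:
  assumes "Q > 0"
  shows "norm (tail_coeff Q m) \<le> cbinom m * real m powr (-1)"
proof (cases "m = 0")
  case False
  hence "real m ^ Q \<ge> real m ^ 1" using assms by (intro power_increasing) auto
  hence "cbinom m / real m ^ Q \<le> cbinom m / real m"
    using cbinom_pos[of m] False by (intro divide_left_mono) auto
  thus ?thesis using cbinom_pos[of m] False
    by (simp add: tail_coeff_def norm_divide norm_mult norm_power powr_minus_divide)
qed (simp add: tail_coeff_def)

text \<open>The weight is the growth rate of shifted windows in \<open>U_bound\<close>. Since Q > 0
  gives decay m^(-3/2), any bound m^e with 0 < e < 1/2 on the weight suffices; e = 1/4 is
  chosen.\<close>

lemma summable_tail_coeff_harm:
  assumes "Q > 0"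
  shows "summable (\<lambda>m. norm (tail_coeff Q m) * (1 + harm m))"
proof (rule summable_comparison_test_bigo)
  have "(\<lambda>m. norm (tail_coeff Q m)) \<in> O(\<lambda>m. cbinom m * real m powr (-1))"
    using norm_tail_coeff_le[OF assms] cbinom_pos
    by (intro bigoI[of _ 1] always_eventually allI) (simp add: abs_mult abs_of_pos)
  also have "(\<lambda>m. cbinom m * real m powr (-1)) \<in> O(\<lambda>m. real m powr (-1/2) * real m powr (-1))"
    by (intro landau_o.big.mult cbinom_bigo) simp
  finally have "(\<lambda>m. norm (tail_coeff Q m) * (1 + harm m)) \<in>
      O(\<lambda>m. real m powr (-1/2) * real m powr (-1) * real m powr (1/4))"
    by (intro landau_o.big.mult harm_bigo)
  also have "(\<lambda>m::nat. real m powr (-1/2) * real m powr (-1) * real m powr (1/4)) \<in> O(\<lambda>m. real m powr (-5/4))"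
    by real_asymp
  finally show "(\<lambda>m. norm (tail_coeff Q m) * (1 + harm m)) \<in> O(\<lambda>m. real m powr (-5/4))" .
  show "summable (\<lambda>m. norm (real m powr (-5/4)))"
    using summable_real_powr_iff[of "-5/4"] by simp
qed

definition tail_frac :: "nat \<Rightarrow> complex \<Rightarrow> complex" where
  "tail_frac Q s = (\<Sum>m. tail_coeff Q m / (s + of_nat m))"

lemma tail_frac_sums: "(\<lambda>m. tail_coeff Q m / (s + of_nat m)) sums tail_frac Q s"
proof -
  have "norm (tail_coeff Q m / (s + of_nat m)) \<le> norm (of_real (cbinom m) / (s + of_nat m))" for m
    using norm_tail_coeff_le_cbinom[of Q m] cbinom_pos[of m] by (simp add: norm_divide divide_right_mono)
  hence "summable (\<lambda>m. tail_coeff Q m / (s + of_nat m))"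
    by (intro summable_comparison_test'[OF summable_cbinom_over_shift[of s]])
  thus ?thesis unfolding tail_frac_def by (rule summable_sums)
qed

text \<open>Termwise this is 1/(s+m) = 1/m - s / (m (s+m)). The constant split off becomes the next
  polar coefficient when dividing by a further s.\<close>

lemma tail_frac_rec:
  assumes "s \<notin> \<int>\<^sub>\<le>\<^sub>0"
  shows "tail_frac Q s = tail_frac Q 0 + s * tail_frac (Suc Q) s"
proof -
  have "(\<lambda>m. tail_coeff Q m / (0 + of_nat m) + s * (tail_coeff (Suc Q) m / (s + of_nat m))) sums (tail_frac Q 0 + s * tail_frac (Suc Q) s)"
    by (intro sums_add sums_mult tail_frac_sums)
  moreover have "tail_coeff Q m / (0 + of_nat m) + s * (tail_coeff (Suc Q) m / (s + of_nat m)) = tail_coeff Q m / (s + of_nat m)" for m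
  proof (cases "m = 0")
    case False
    have "tail_coeff (Suc Q) m = - (tail_coeff Q m / of_nat m)" using False by (simp add: tail_coeff_def)
    moreover have "r / (0 + of_nat m) + s * (- (r / of_nat m) / (s + of_nat m)) = r / (s + of_nat m)" for r
    proof -
      have "s / (s + of_nat m) = 1 - of_nat m / (s + of_nat m)"
        using nonpos_Ints_plus_of_nat[OF assms, of m] by (simp add: field_simps)
      moreover have "s * (- (r / of_nat m) / (s + of_nat m)) = - (r / of_nat m) * (s / (s + of_nat m))"
        by simp
      ultimately have "s * (- (r / of_nat m) / (s + of_nat m)) = - (r / of_nat m) * (1 - of_nat m / (s + of_nat m))"
        by (simp only:)
      also have "\<dots> = - (r / of_nat m) + r / (s + of_nat m)"
        using False by (simp add: right_diff_distrib)
      finally show ?thesis by simp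
    qed
    ultimately show ?thesis by simp
  qed (simp add: tail_coeff_def)
  ultimately show ?thesis using sums_unique2[OF tail_frac_sums] by simp
qed

lemma small_not_nonpos_Ints:
  fixes s :: complex
  assumes "s \<in> ball 0 1 - {0}"
  shows "s \<notin> \<int>\<^sub>\<le>\<^sub>0"
proof
  assume "s \<in> \<int>\<^sub>\<le>\<^sub>0"
  then obtain k where "s = - of_nat k" by (rule nonpos_Ints_cases')
  with assms show False by auto
qed

text \<open>By \<open>tail_frac_rec\<close> the increment is s times the tail of next order, which
  is bounded near 0: its poles start at -1 and its coefficients are absolutely summable.\<close>

lemma tail_frac_tendsto: "(tail_frac Q \<longlongrightarrow> tail_frac Q 0) (at 0)"
proof -
  have sm: "summable (\<lambda>m. norm (tail_coeff (Suc Q) m))"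
  proof (rule summable_comparison_test'[OF summable_tail_coeff_harm[of "Suc Q"]])
    fix m show "norm (norm (tail_coeff (Suc Q) m)) \<le> norm (tail_coeff (Suc Q) m) * (1 + harm m)"
      using harm_nonneg[of m, where ?'a = real] by (simp add: distrib_left)
  qed simp
  define M where "M = (\<Sum>m. 2 * norm (tail_coeff (Suc Q) m))"
  have near: "\<forall>\<^sub>F s in at (0::complex). s \<in> ball 0 (1/2) - {0}"
    by (rule eventually_at_in_open) auto
  have bound: "norm (tail_frac (Suc Q) s) \<le> M" if "s \<in> ball 0 (1/2)" for s
  proof -
    have "norm (tail_coeff (Suc Q) m / (s + of_nat m)) \<le> 2 * norm (tail_coeff (Suc Q) m)" for m
    proof (cases "m = 0")
      case False
      have "norm (of_nat m :: complex) - norm s \<le> norm (of_nat m + s)" by (rule norm_diff_ineq)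
      hence "norm (s + of_nat m) \<ge> 1/2" using that False by (simp add: add.commute)
      hence "norm (tail_coeff (Suc Q) m) / norm (s + of_nat m) \<le> norm (tail_coeff (Suc Q) m) / (1/2)"
        by (intro divide_left_mono mult_pos_pos) auto
      thus ?thesis by (simp add: norm_divide)
    qed (simp add: tail_coeff_def)
    thus ?thesis unfolding M_def
      by (intro norm_sums_le[OF tail_frac_sums summable_sums] summable_mult sm)
  qed
  have "((\<lambda>s. tail_frac Q 0 + s * tail_frac (Suc Q) s) \<longlongrightarrow> tail_frac Q 0 + 0) (at 0)"
  proof (intro tendsto_add tendsto_const Lim_null_comparison[of "\<lambda>s. s * tail_frac (Suc Q) s" "\<lambda>s. norm s * M"])
    show "\<forall>\<^sub>F s in at 0. norm (s * tail_frac (Suc Q) s) \<le> norm s * M"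
      using near by eventually_elim (auto simp: norm_mult intro!: mult_left_mono bound)
    have "((\<lambda>s::complex. norm s * M) \<longlongrightarrow> norm (0::complex) * M) (at 0)"
      by (intro tendsto_mult tendsto_norm tendsto_ident_at tendsto_const)
    thus "((\<lambda>s::complex. norm s * M) \<longlongrightarrow> 0) (at 0)" by simp
  qed
  moreover have "\<forall>\<^sub>F s in at 0. tail_frac Q 0 + s * tail_frac (Suc Q) s = tail_frac Q s"
    using near
  proof eventually_elim
    case (elim s)
    hence "s \<notin> \<int>\<^sub>\<le>\<^sub>0" by (intro small_not_nonpos_Ints) auto
    thus ?case by (rule tail_frac_rec [symmetric])
  qed
  ultimately have "(tail_frac Q \<longlongrightarrow> tail_frac Q 0 + 0) (at 0)" by (rule Lim_transform_eventually)
  thus ?thesis by simp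
qed

section \<open>The polar part at 0\<close>

lemma eval_fps_split:
  fixes F :: "complex fps"
  assumes "norm z < fps_conv_radius F"
  shows "eval_fps F z = (\<Sum>i<n. fps_nth F i * z ^ i) + z ^ n * eval_fps (fps_shift n F) z"
proof -
  have "norm z < fps_conv_radius (fps_shift n F)" using assms by simp
  hence "(\<lambda>i. z ^ n * (fps_nth (fps_shift n F) i * z ^ i)) sums (z ^ n * eval_fps (fps_shift n F) z)"
    by (intro sums_mult sums_eval_fps)
  hence "(\<lambda>i. fps_nth F (i + n) * z ^ (i + n)) sums (z ^ n * eval_fps (fps_shift n F) z)"
    by (simp add: power_add mult_ac)
  from sums_iff_shift[THEN iffD1, OF this]
  show ?thesis using sums_unique2[OF sums_eval_fps[OF assms]] by (simp add: add.commute)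
qed

lemma central_gf_0: "fps_nth central_gf_fps 0 = 1"
  by (simp add: central_gf_fps_def)

text \<open>In the induction, the new coefficient is the constant \<open>tail_frac Q 0\<close>.
  Multiplying the induction hypothesis by s^(Q+1) shows that near 0 the tail equals the remainder of
  \<open>central_gf_fps\<close> after its first Q + 1 terms; letting s -> 0 identifies the constant
  as the next coefficient.\<close>

theorem Beta_half_over_power:
  assumes "s \<notin> \<int>\<^sub>\<le>\<^sub>0"
  shows "Beta s (1/2) / s ^ Q = (\<Sum>i\<le>Q. fps_nth central_gf_fps i / s ^ (Suc Q - i)) + tail_frac Q s"
  using assms
proof (induction Q arbitrary: s)
  case 0
  have "(\<lambda>m. tail_coeff 0 m / (s + of_nat m)) sums (Beta s (1/2) - of_real (cbinom 0) / (s + of_nat 0))"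
  proof -
    have "(\<lambda>m. of_real (cbinom m) / (s + of_nat m) - (if m = 0 then of_real (cbinom 0) / (s + of_nat 0) else 0))
        sums (Beta s (1/2) - of_real (cbinom 0) / (s + of_nat 0))"
      by (intro sums_diff Beta_half_partial_fractions[OF 0] sums_single)
    moreover have "of_real (cbinom m) / (s + of_nat m) - (if m = 0 then of_real (cbinom 0) / (s + of_nat 0) else 0)
        = tail_coeff 0 m / (s + of_nat m)" for m by (simp add: tail_coeff_def)
    ultimately show ?thesis by simp
  qed
  thus ?case using sums_unique2[OF tail_frac_sums] by (simp add: central_gf_0)
next
  case (Suc Q)
  let ?g = "fps_nth central_gf_fps"
  have rad: "fps_conv_radius central_gf_fps > 0"
    using has_fps_expansion_central_gf by (simp add: has_fps_expansion_def)
  have "((\<lambda>s. eval_fps (fps_shift (Suc Q) central_gf_fps) s) \<longlongrightarrow> eval_fps (fps_shift (Suc Q) central_gf_fps) 0) (at 0)"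
    using continuous_eval_fps[of 0 "fps_shift (Suc Q) central_gf_fps" UNIV] rad
    by (simp add: continuous_within zero_ereal_def)
  hence lim: "((\<lambda>s. eval_fps (fps_shift (Suc Q) central_gf_fps) s) \<longlongrightarrow> ?g (Suc Q)) (at 0)"
    by (simp add: eval_fps_at_0)
  have "\<forall>\<^sub>F s in at (0::complex). s \<in> ball 0 1 - {0}"
    by (rule eventually_at_in_open) auto
  moreover have "\<forall>\<^sub>F s in at (0::complex). s \<in> eball 0 (fps_conv_radius central_gf_fps) - {0}"
    using rad by (intro eventually_at_in_open) (auto simp: zero_ereal_def)
  ultimately have "\<forall>\<^sub>F s in at 0. eval_fps (fps_shift (Suc Q) central_gf_fps) s = tail_frac Q s"
    using central_gf_eventually
  proof eventually_elim
    case (elim s)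
    have s: "s \<noteq> 0" "s \<notin> \<int>\<^sub>\<le>\<^sub>0" using elim(1) small_not_nonpos_Ints by auto
    have "s * Beta s (1/2) = (\<Sum>i\<le>Q. ?g i * s ^ i) + s ^ Suc Q * eval_fps (fps_shift (Suc Q) central_gf_fps) s"
      using eval_fps_split[of s central_gf_fps "Suc Q"] elim by (simp add: lessThan_Suc_atMost)
    moreover have "s * Beta s (1/2) = s ^ Suc Q * (Beta s (1/2) / s ^ Q)" using s by simp
    moreover have "s ^ Suc Q * (\<Sum>i\<le>Q. ?g i / s ^ (Suc Q - i)) = (\<Sum>i\<le>Q. ?g i * s ^ i)"
      unfolding sum_distrib_left using s
      by (intro sum.cong refl) (auto simp: power_diff field_simps)
    ultimately have "s ^ Suc Q * tail_frac Q s = s ^ Suc Q * eval_fps (fps_shift (Suc Q) central_gf_fps) s"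
      unfolding Suc.IH[OF s(2)] distrib_left by simp
    thus ?case using s(1) by simp
  qed
  with lim have "(tail_frac Q \<longlongrightarrow> ?g (Suc Q)) (at 0)" by (rule Lim_transform_eventually)
  from tendsto_unique[OF _ tail_frac_tendsto this] have g: "tail_frac Q 0 = ?g (Suc Q)" by simp
  have nz: "s \<noteq> 0" using Suc.prems by auto
  have "Beta s (1/2) / s ^ Suc Q = (Beta s (1/2) / s ^ Q) / s" by simp
  also have "\<dots> = ((\<Sum>i\<le>Q. ?g i / s ^ (Suc Q - i)) + (?g (Suc Q) + s * tail_frac (Suc Q) s)) / s"
    unfolding Suc.IH[OF Suc.prems] tail_frac_rec[OF Suc.prems, of Q] g ..
  also have "\<dots> = (\<Sum>i\<le>Q. ?g i / s ^ (Suc Q - i)) / s + ?g (Suc Q) / s + tail_frac (Suc Q) s"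
    using nz by (simp add: add_divide_distrib)
  also have "(\<Sum>i\<le>Q. ?g i / s ^ (Suc Q - i)) / s = (\<Sum>i\<le>Q. ?g i / s ^ (Suc (Suc Q) - i))"
    unfolding sum_divide_distrib by (intro sum.cong refl) (simp add: Suc_diff_le)
  finally show ?case by simp
qed

section \<open>Five-fold Cauchy products as sums over tuples\<close>

lemma finite_fibre_add:
  fixes d :: "'b \<Rightarrow> nat"
  assumes "\<And>n. finite {r. d r = n}"
  shows "finite {p. fst p + d (snd p) = n}"
proof -
  have "{p. fst p + d (snd p) = n} = Sigma {0..n} (\<lambda>k. {r. d r = n - k})" by auto
  thus ?thesis using assms by (simp only:) (intro finite_SigmaI; simp)
qed

text \<open>The second factor is indexed by an arbitrary type graded by \<open>d\<close>, so the
  rule iterates: four applications index a five-fold product by nested pairs of total degree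
  n.\<close>

lemma fps_mult_nth_fibre:
  fixes F G :: "complex fps" and d :: "'b \<Rightarrow> nat"
  assumes "\<And>n. finite {r. d r = n}" and "\<And>n. fps_nth G n = (\<Sum>r\<in>{r. d r = n}. \<phi> r)"
  shows "fps_nth (F * G) n = (\<Sum>p\<in>{p. fst p + d (snd p) = n}. fps_nth F (fst p) * \<phi> (snd p))"
proof -
  have eq: "{p. fst p + d (snd p) = n} = Sigma {0..n} (\<lambda>k. {r. d r = n - k})" by auto
  show ?thesis
    unfolding eq fps_mult_nth assms(2) sum_distrib_left
    by (subst sum.Sigma) (use assms(1) in \<open>auto simp: case_prod_unfold\<close>)
qed

lemma fps_mult5_nth:
  fixes A B C D E :: "complex fps"
  shows "fps_nth (A * B * C * D * E) n =
    (\<Sum>(k1, k2, k3, k4, k5) \<in> {(k1, k2, k3, k4, k5). k1 + k2 + k3 + k4 + k5 = n}.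
      fps_nth A k1 * fps_nth B k2 * fps_nth C k3 * fps_nth D k4 * fps_nth E k5)"
proof -
  have f1: "finite {k::nat. k = n}" and s1: "fps_nth E n = (\<Sum>k\<in>{k. k = n}. fps_nth E k)" for n
    by simp_all
  note f2 = finite_fibre_add[OF f1] and s2 = fps_mult_nth_fibre[OF f1 s1, of D]
  note f3 = finite_fibre_add[OF f2] and s3 = fps_mult_nth_fibre[OF f2 s2, of C]
  note f4 = finite_fibre_add[OF f3] and s4 = fps_mult_nth_fibre[OF f3 s3, of B]
  note s5 = fps_mult_nth_fibre[OF f4 s4, of A n]
  have "A * B * C * D * E = A * (B * (C * (D * E)))" by (simp only: mult.assoc)
  thus ?thesis using s5 by (simp add: case_prod_unfold add.assoc mult.assoc)
qed

text \<open>The sequence \<open>c\<close> serves as the coefficients of a fifth power series,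
  multiplied onto the four factors of \<open>central_gf_fps\<close>.\<close>

lemma sum_coeffs_eq:
  "(\<Sum>(k1, k2, k3, k4, k5) \<in> {(k1, k2, k3, k4, k5). k1 + k2 + k3 + k4 + k5 = Q}.
            coeff_C k1 * coeff_C k2 * coeff_D k3 * 2 ^ (k3 + k4)
            / (fact k1 * fact k2 * fact k3 * fact k4)
            * of_real (ln 2) ^ k4 * c k5) = (\<Sum>i\<le>Q. fps_nth central_gf_fps i * c (Q - i))"
proof -
  have "(\<Sum>i\<le>Q. fps_nth central_gf_fps i * c (Q - i)) = fps_nth (central_gf_fps * Abs_fps c) Q"
    by (simp add: fps_mult_nth atLeast0AtMost)
  also have "\<dots> = (\<Sum>(k1, k2, k3, k4, k5) \<in> {(k1, k2, k3, k4, k5). k1 + k2 + k3 + k4 + k5 = Q}.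
            coeff_C k1 * coeff_C k2 * coeff_D k3 * 2 ^ (k3 + k4)
            / (fact k1 * fact k2 * fact k3 * fact k4)
            * of_real (ln 2) ^ k4 * c k5)"
    unfolding central_gf_fps_def fps_mult5_nth
    by (intro sum.cong refl) (auto simp: coeff_C_eq coeff_D_eq power_add power_mult_distrib)
  finally show ?thesis ..
qed

section \<open>Twisted two-sided sums of partial fractions\<close>

text \<open>Half-open, so that it collects the first N terms of each half of
  \<open>bi_suminf\<close>.\<close>

definition bisum :: "nat \<Rightarrow> (int \<Rightarrow> complex) \<Rightarrow> complex" where
  "bisum N f = (\<Sum>k\<in>{- int N..<int N}. f k)"

lemma bisum_eq: "bisum N f = (\<Sum>n<N. f (int n)) + (\<Sum>n<N. f (- int (Suc n)))"
proof (induction N)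
  case (Suc N)
  have "{- int (Suc N)..<int (Suc N)} = insert (int N) (insert (- int (Suc N)) {- int N..<int N})"
    by auto
  with Suc show ?case by (simp add: bisum_def)
qed (simp add: bisum_def)

lemma bisum_tendsto_bi_suminf:
  assumes "bi_summable f"
  shows "(\<lambda>N. bisum N f) \<longlonglongrightarrow> bi_suminf f"
  unfolding bisum_eq bi_suminf_def
  using assms by (intro tendsto_add summable_LIMSEQ) (auto simp: bi_summable_def)

text \<open>The integers are closed, so -a has a distance d > 0 from them. Then 1 + |k| <= |k+a| +
  (1 + |a|) and 1 <= |k+a| / d give c = 1 + (1 + |a|) / d.\<close>

lemma norm_inverse_int_shift_le:
  fixes a :: complex
  assumes "a \<notin> \<int>"
  obtains c where "c > 0" "\<And>k. norm (inverse (of_int k + a)) \<le> c / (1 + \<bar>real_of_int k\<bar>)"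
proof -
  have "-a \<in> - \<int>" using assms by (metis Compl_iff Ints_minus minus_minus)
  moreover have op: "open (- \<int> :: complex set)" by (simp add: open_Compl)
  ultimately obtain d where d: "d > 0" "ball (-a) d \<subseteq> - \<int>"
    using openE[OF op] by metis
  have ge: "norm (of_int k + a) \<ge> d" for k
  proof -
    have "(of_int k :: complex) \<notin> - \<int>" by simp
    hence "of_int k \<notin> ball (-a) d" using d(2) by (meson subsetD)
    moreover have "dist (-a) (of_int k) = norm (of_int k + a)"
      unfolding dist_norm by (subst norm_minus_cancel [symmetric]) (simp add: add.commute)
    ultimately show ?thesis by simp
  qed
  define c where "c = 1 + (1 + norm a) / d"
  have "norm (inverse (of_int k + a)) \<le> c / (1 + \<bar>real_of_int k\<bar>)" for k
  proof -
    have "\<bar>real_of_int k\<bar> = norm (of_int k + a - a)" by simp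
    also have "\<dots> \<le> norm (of_int k + a) + norm a" by (rule norm_triangle_ineq4)
    finally have "1 + \<bar>real_of_int k\<bar> \<le> norm (of_int k + a) + (1 + norm a) * 1" by simp
    also have "\<dots> \<le> norm (of_int k + a) + (1 + norm a) * (norm (of_int k + a) / d)"
      using ge[of k] d by (intro add_left_mono mult_left_mono) (auto simp: field_simps)
    also have "\<dots> = c * norm (of_int k + a)" by (simp add: c_def algebra_simps)
    finally have "1 + \<bar>real_of_int k\<bar> \<le> c * norm (of_int k + a)" .
    moreover have "norm (of_int k + a) > 0" using ge[of k] d by linarith
    moreover have "1 + \<bar>real_of_int k\<bar> > 0" by linarith
    ultimately show ?thesis unfolding norm_inverse inverse_eq_divide
      by (simp add: norm_divide pos_divide_le_eq pos_le_divide_eq del: zero_less_norm_iff)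
  qed
  moreover have "c > 0" using d by (simp add: c_def add_pos_nonneg)
  ultimately show ?thesis using that by blast
qed

text \<open>Uniform in N: the terms below N and those from N on are each bounded by a harmonic sum
  with at most m terms.\<close>

lemma sum_inverse_dist_le_harm:
  "(\<Sum>j<m. 1 / (1 + \<bar>real j - real N\<bar>)) \<le> 2 * harm m"
proof -
  define K where "K = min m N"
  have "{..<m} = {..<K} \<union> {N..<m}" by (auto simp: K_def)
  moreover have "{..<K} \<inter> {N..<m} = {}" by (auto simp: K_def)
  ultimately have "(\<Sum>j<m. 1 / (1 + \<bar>real j - real N\<bar>)) =
      (\<Sum>j<K. 1 / (1 + \<bar>real j - real N\<bar>)) + (\<Sum>j\<in>{N..<m}. 1 / (1 + \<bar>real j - real N\<bar>))"
    by (simp add: sum.union_disjoint)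
  also have "(\<Sum>j<K. 1 / (1 + \<bar>real j - real N\<bar>)) \<le> (\<Sum>j<K. inverse (real (Suc (K - Suc j))))"
    by (intro sum_mono) (auto simp: K_def field_simps)
  also have "\<dots> = harm K"
    unfolding harm_altdef by (rule sum.nat_diff_reindex)
  also have "(\<Sum>j\<in>{N..<m}. 1 / (1 + \<bar>real j - real N\<bar>)) = harm (m - N)"
    unfolding harm_altdef
    by (intro sum.reindex_bij_witness[of _ "\<lambda>i. i + N" "\<lambda>j. j - N"]) (auto simp: field_simps)
  also have "harm K + harm (m - N) \<le> harm m + (harm m :: real)"
    by (intro add_mono harm_mono) (auto simp: K_def)
  finally show ?thesis by simp
qed

text \<open>S is a limit over symmetric windows only, which includes x = 1, where the two halves
  diverge.\<close>

locale twisted_sum =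
  fixes x a S :: complex
  assumes norm_x: "norm x = 1" and a: "a \<notin> \<int>"
    and S: "(\<lambda>N. bisum N (\<lambda>k. x powi (-k) / (of_int k + a))) \<longlonglongrightarrow> S"
begin

definition w :: "int \<Rightarrow> complex" where "w k = x powi (-k) / (of_int k + a)"

definition U :: "nat \<Rightarrow> nat \<Rightarrow> complex" where
  "U N m = (\<Sum>k\<in>{int m - int N..<int m + int N}. w k)"

lemma x_nz [simp]: "x \<noteq> 0" using norm_x by auto

lemma norm_xi [simp]: "norm (x powi k) = 1"
  by (simp add: norm_power_int norm_x)

lemma norm_w: "norm (w k) = norm (inverse (of_int k + a))"
  by (simp add: w_def norm_divide norm_inverse divide_inverse norm_mult)

lemma U_Suc: "U N (Suc m) = U N m + (w (int m + int N) - w (int m - int N))"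
proof (cases "N = 0")
  case False
  let ?I = "{int m + 1 - int N..<int m + int N}"
  have 1: "{int (Suc m) - int N..<int (Suc m) + int N} = insert (int m + int N) ?I"
    and 2: "{int m - int N..<int m + int N} = insert (int m - int N) ?I"
    using False by auto
  show ?thesis unfolding U_def 1 2 by simp
qed (simp add: U_def)

lemma w_at_top: "(\<lambda>N. w (int m + int N)) \<longlonglongrightarrow> 0"
  and w_at_bot: "(\<lambda>N. w (int m - int N)) \<longlonglongrightarrow> 0"
proof -
  obtain c where c: "c > 0" "\<And>k. norm (inverse (of_int k + a)) \<le> c / (1 + \<bar>real_of_int k\<bar>)"
    using norm_inverse_int_shift_le[OF a] by blast
  show "(\<lambda>N. w (int m + int N)) \<longlonglongrightarrow> 0"
  proof (rule Lim_null_comparison)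
    show "(\<lambda>N::nat. c / (1 + \<bar>real_of_int (int m + int N)\<bar>)) \<longlonglongrightarrow> 0" by real_asymp
  qed (unfold norm_w, intro always_eventually allI c)
  show "(\<lambda>N. w (int m - int N)) \<longlonglongrightarrow> 0"
  proof (rule Lim_null_comparison)
    show "(\<lambda>N::nat. c / (1 + \<bar>real_of_int (int m - int N)\<bar>)) \<longlonglongrightarrow> 0" by real_asymp
  qed (unfold norm_w, intro always_eventually allI c)
qed

lemma U_tendsto: "(\<lambda>N. U N m) \<longlonglongrightarrow> S"
proof (induction m)
  case 0
  show ?case using S by (simp add: U_def w_def bisum_def)
next
  case (Suc m)
  have "(\<lambda>N. U N m + (w (int m + int N) - w (int m - int N))) \<longlonglongrightarrow> S + (0 - 0)"
    by (intro tendsto_intros Suc w_at_top w_at_bot)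
  thus ?case by (simp add: U_Suc)
qed

text \<open>
  For \<open>m\<close> close to \<open>N\<close> the window is one-sided, so harmonic growth in \<open>m\<close> is the best possible bound.
\<close>

lemma U_bound: obtains C where "\<And>N m. norm (U N m) \<le> C * (1 + harm m)"
proof -
  obtain c where c: "c > 0" "\<And>k. norm (inverse (of_int k + a)) \<le> c / (1 + \<bar>real_of_int k\<bar>)"
    using norm_inverse_int_shift_le[OF a] by blast
  have "Bseq (\<lambda>N. U N 0)" by (rule convergent_imp_Bseq[OF convergentI[OF U_tendsto]])
  then obtain M where M: "M > 0" "\<And>N. norm (U N 0) \<le> M"
    by (rule BseqE) blast
  \<comment> \<open>By \<open>U_Suc\<close>, moving the window by one adds the index m + N, at cost
    at most c / (m + 1), and drops m - N, at cost at most c / (1 + |m - N|). The two sums are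
    \<open>harm m\<close> and at most \<open>2 * harm m\<close>, hence the factor 3 below.\<close>
  have 1: "norm (U N m) \<le> M + c * (\<Sum>j<m. inverse (real (Suc j)) + 1 / (1 + \<bar>real j - real N\<bar>))" for N m
  proof (induction m)
    case (Suc m)
    have "norm (U N (Suc m)) \<le> norm (U N m) + (norm (w (int m + int N)) + norm (w (int m - int N)))"
      unfolding U_Suc by (meson norm_triangle_ineq norm_triangle_ineq4 order.trans add_left_mono)
    also have "norm (w (int m + int N)) \<le> c / (1 + \<bar>real_of_int (int m + int N)\<bar>)"
      unfolding norm_w by (rule c)
    also have "\<dots> \<le> c * inverse (real (Suc m))"
      unfolding divide_inverse using c(1) by (intro mult_left_mono le_imp_inverse_le) auto
    also have "norm (w (int m - int N)) \<le> c / (1 + \<bar>real_of_int (int m - int N)\<bar>)"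
      unfolding norm_w by (rule c)
    also note Suc
    finally show ?case by (simp add: algebra_simps)
  qed (simp add: M)
  have "norm (U N m) \<le> (M + 3 * c) * (1 + harm m)" for N m
  proof -
    have "(\<Sum>j<m. inverse (real (Suc j)) + 1 / (1 + \<bar>real j - real N\<bar>)) \<le> harm m + 2 * harm m"
      unfolding sum.distrib using sum_inverse_dist_le_harm[of N m] by (simp add: harm_altdef)
    hence "c * (\<Sum>j<m. inverse (real (Suc j)) + 1 / (1 + \<bar>real j - real N\<bar>)) \<le> c * (harm m + 2 * harm m)"
      using c(1) by (intro mult_left_mono) auto
    with 1[of N m] have "norm (U N m) \<le> M + c * (3 * harm m)" by simp
    also have "\<dots> \<le> M + c * (3 * harm m) + (M * harm m + 3 * c)"
      using M(1) c(1) harm_nonneg[of m, where ?'a = real] by simp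
    finally show ?thesis by (simp add: algebra_simps)
  qed
  thus ?thesis using that by blast
qed

text \<open>Replacing k by k - m moves the pole from -m to 0 and takes x^m out of the twist, at the
  price of moving the window.\<close>

lemma bisum_pole:
  "bisum N (\<lambda>k. x powi (-k) * (r / (of_int k + a + of_nat m))) = r * x ^ m * U N m"
proof -
  have "bisum N (\<lambda>k. x powi (-k) * (r / (of_int k + a + of_nat m))) =
      (\<Sum>k\<in>{int m - int N..<int m + int N}. r * x ^ m * w k)"
    unfolding bisum_def
  proof (intro sum.reindex_bij_witness[of _ "\<lambda>k. k - int m" "\<lambda>k. k + int m"])
    fix k assume "k \<in> {- int N..<int N}"
    have "x ^ m * x powi (- (k + int m)) = x powi (int m + - (k + int m))"
      by (subst power_int_add) auto
    also have "int m + - (k + int m) = -k" by simp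
    finally have *: "x ^ m * x powi (- (k + int m)) = x powi (-k)" .
    have "r * x ^ m * w (k + int m) = r * (x ^ m * x powi (- (k + int m))) / (of_int k + a + of_nat m)"
      by (simp add: w_def add_ac)
    thus "r * x ^ m * w (k + int m) = x powi (-k) * (r / (of_int k + a + of_nat m))"
      unfolding * by simp
  qed auto
  thus ?thesis by (simp add: U_def sum_distrib_left)
qed

text \<open>For fixed N the finite sum over k passes through the series over m. Tannery's theorem
  then applies with the majorant C |r m| (1 + harm m) from \<open>U_bound\<close>, as every shifted
  window has the same limit S.\<close>

theorem bisum_partial_fractions:
  assumes r: "summable (\<lambda>m. norm (r m) * (1 + harm m))"
    and H: "\<And>k. (\<lambda>m. r m / (of_int k + a + of_nat m)) sums H k"
  shows "(\<lambda>N. bisum N (\<lambda>k. x powi (-k) * H k)) \<longlonglongrightarrow> S * (\<Sum>m. r m * x ^ m)"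
proof -
  obtain C where C: "\<And>N m. norm (U N m) \<le> C * (1 + harm m)"
    using U_bound by blast
  have eq: "(\<Sum>m. r m * x ^ m * U N m) = bisum N (\<lambda>k. x powi (-k) * H k)" for N
  proof -
    have "(\<lambda>m. \<Sum>k\<in>{- int N..<int N}. x powi (-k) * (r m / (of_int k + a + of_nat m))) sums
        (\<Sum>k\<in>{- int N..<int N}. x powi (-k) * H k)"
      by (intro sums_sum sums_mult H)
    thus ?thesis using bisum_pole by (simp add: bisum_def sums_iff)
  qed
  have "(\<lambda>N. \<Sum>m. r m * x ^ m * U N m) \<longlonglongrightarrow> (\<Sum>m. r m * x ^ m * S)"
  proof (intro tannerys_theorem[THEN conjunct2, THEN conjunct2])
    show "summable (\<lambda>m. C * (norm (r m) * (1 + harm m)))" by (intro summable_mult r)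
    show "\<forall>\<^sub>F (m, N) in sequentially \<times>\<^sub>F sequentially. norm (r m * x ^ m * U N m) \<le> C * (norm (r m) * (1 + harm m))"
    proof (intro always_eventually allI, clarify)
      fix m N
      have "norm (r m) * norm (U N m) \<le> norm (r m) * (C * (1 + harm m))"
        by (intro mult_left_mono C) auto
      thus "norm (r m * x ^ m * U N m) \<le> C * (norm (r m) * (1 + harm m))"
        by (simp add: norm_mult norm_power norm_x mult.left_commute)
    qed
  qed (auto intro!: tendsto_intros U_tendsto)
  also have "(\<Sum>m. r m * x ^ m * S) = S * (\<Sum>m. r m * x ^ m)"
  proof -
    have "norm (r m * x ^ m) \<le> norm (r m) * (1 + harm m)" for m
      using harm_nonneg[of m, where ?'a = real]
      by (simp add: norm_mult norm_power norm_x mult_left_le distrib_left)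
    hence "summable (\<lambda>m. r m * x ^ m)" by (intro summable_comparison_test'[OF r])
    from suminf_mult2[OF this, of S] show ?thesis by (simp add: mult.commute)
  qed
  finally show ?thesis unfolding eq .
qed

end

section \<open>Convergence\<close>

lemma norm_bigo_imp_tendsto_0:
  fixes f :: "nat \<Rightarrow> 'a :: real_normed_vector"
  assumes "(\<lambda>n. norm (f n)) \<in> O(g)" "g \<longlonglongrightarrow> (0 :: real)"
  shows "f \<longlonglongrightarrow> 0"
proof -
  obtain c where "\<forall>\<^sub>F n in sequentially. norm (norm (f n)) \<le> c * norm (g n)"
    using assms(1) by (rule landau_o.bigE)
  hence ev: "\<forall>\<^sub>F n in sequentially. norm (f n) \<le> c * norm (g n)" by simp
  show ?thesis
    by (rule Lim_null_comparison[OF ev]) (use tendsto_mult[OF tendsto_const tendsto_norm[OF assms(2)], of c] in simp)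
qed

text \<open>Summation by parts: (1 - y) y^n f n is a telescoping difference minus y^(n+1) (f n - f
  (n+1)).\<close>

lemma summable_twisted:
  fixes y :: complex
  assumes y: "norm y = 1" "y \<noteq> 1" and f: "f \<longlonglongrightarrow> 0" and bv: "summable (\<lambda>n. norm (f n - f (Suc n)))"
  shows "summable (\<lambda>n. y ^ n * f n)"
proof -
  have "(\<lambda>n. y ^ n * f n) \<longlonglongrightarrow> 0"
    using f by (intro Lim_null_comparison[OF _ tendsto_norm_zero[OF f]]) (simp add: norm_mult norm_power y)
  hence "summable (\<lambda>n. y ^ n * f n - y ^ Suc n * f (Suc n))"
    by (rule telescope_summable')
  moreover have "summable (\<lambda>n. y ^ Suc n * (f n - f (Suc n)))"
    by (rule summable_comparison_test'[OF bv]) (simp add: norm_mult norm_power y del: power_Suc)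
  ultimately have "summable (\<lambda>n. (y ^ n * f n - y ^ Suc n * f (Suc n)) - y ^ Suc n * (f n - f (Suc n)))"
    by (rule summable_diff)
  also have "(\<lambda>n. (y ^ n * f n - y ^ Suc n * f (Suc n)) - y ^ Suc n * (f n - f (Suc n))) = (\<lambda>n. (1 - y) * (y ^ n * f n))"
    by (simp add: fun_eq_iff algebra_simps)
  finally show ?thesis using y(2) by (simp only: summable_cmult_iff) simp
qed

lemma summable_twisted_bigo:
  fixes y :: complex
  assumes "norm y = 1" "y \<noteq> 1" "(\<lambda>n. norm (f n)) \<in> O(\<lambda>n. real n powr (-1/2))"
    "(\<lambda>n. norm (f n - f (Suc n))) \<in> O(\<lambda>n. real n powr (-3/2))"
  shows "summable (\<lambda>n. y ^ n * f n)"
proof (rule summable_twisted[OF assms(1,2)])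
  have "(\<lambda>n. real n powr (-1/2)) \<longlonglongrightarrow> 0" by real_asymp
  with assms(3) show "f \<longlonglongrightarrow> 0" by (rule norm_bigo_imp_tendsto_0)
  show "summable (\<lambda>n. norm (f n - f (Suc n)))" by (rule summable_bigo_powr[OF assms(4)]) simp
qed

lemma summable_power_mult_bigo:
  fixes y :: complex
  assumes "norm y = 1" "(\<lambda>n. norm (f n)) \<in> O(\<lambda>n. real n powr (-3/2))"
  shows "summable (\<lambda>n. y ^ n * f n)"
proof -
  have "summable (\<lambda>n. norm (f n))" by (rule summable_bigo_powr[OF assms(2)]) simp
  thus ?thesis
    by (rule summable_comparison_test') (simp add: norm_mult norm_power assms(1))
qed

lemma power_bigo:
  fixes f :: "nat \<Rightarrow> complex"
  assumes "(\<lambda>n. norm (f n)) \<in> O(\<lambda>n. real n powr (-1))" "Q > 0"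
  shows "(\<lambda>n. norm (f n ^ Q)) \<in> O(\<lambda>n. real n powr (-1))"
proof -
  have "(\<lambda>n. norm (f n) ^ Q) \<in> O(\<lambda>n. (real n powr (-1)) ^ Q)"
    by (rule landau_o.big_power[OF assms(1)])
  also have "(\<lambda>n. (real n powr (-1)) ^ Q) \<in> O(\<lambda>n. real n powr (-1))"
  proof (rule bigoI[of _ 1], use eventually_gt_at_top[of 0] in eventually_elim)
    case (elim n)
    have "(real n powr (-1)) ^ Q \<le> (real n powr (-1)) ^ 1"
      using assms(2) elim by (intro power_decreasing) (auto simp: powr_minus_divide)
    thus ?case by simp
  qed
  finally show ?thesis by (simp only: norm_power)
qed

lemma norm_inverse_shift_neg_bigo:
  "(\<lambda>n. norm (inverse (s - of_nat n :: complex))) \<in> O(\<lambda>n. real n powr (-1))"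
proof -
  have "norm (inverse (s - of_nat n)) = norm (inverse (- s + of_nat n))" for n
    by (metis norm_inverse norm_minus_commute uminus_add_conv_diff)
  thus ?thesis using norm_inverse_shift_bigo[of "-s"] by (simp only:)
qed

lemma not_Ints_imp_not_nonpos_Ints: "s \<notin> \<int> \<Longrightarrow> s \<notin> \<int>\<^sub>\<le>\<^sub>0"
  by (auto elim!: nonpos_Ints_cases)

lemma Beta_half_minus1:
  fixes s :: complex
  assumes "s \<notin> \<int>\<^sub>\<le>\<^sub>0"
  shows "Beta s (1/2) = (s + 1/2) / s * Beta (s + 1) (1/2)"
proof -
  have "s \<noteq> 0" using assms by auto
  thus ?thesis using Beta_half_plus1[OF assms] by simp
qed

text \<open>Under the reflection s -> 1/2 - s, the sequence going left from a obeys the same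
  first-order recurrence as the one going right from t = 1/2 - a. Beyond an index k with Re (t + k)
  > 0 the two are proportional, so the bound on the right carries over.\<close>

lemma norm_Beta_half_neg_bigo:
  fixes a :: complex
  assumes "a \<notin> \<int>"
  shows "(\<lambda>n. norm (Beta (a - of_nat n) (1/2))) \<in> O(\<lambda>n. real n powr (-1/2))"
proof -
  define t where "t = 1/2 - a"
  obtain k :: nat where "real k > - Re t" using reals_Archimedean2 by blast
  hence k: "Re t + real k > 0" by simp
  have step_u: "Beta (a - of_nat (Suc n)) (1/2) = (t + of_nat n) / (t + of_nat n + 1/2) * Beta (a - of_nat n) (1/2)" for n
  proof -
    let ?s = "a - of_nat (Suc n)"
    have nI: "?s \<notin> \<int>"
      using assms by (metis Ints_add Ints_of_nat diff_add_cancel)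
    have s: "?s \<notin> \<int>\<^sub>\<le>\<^sub>0" by (rule not_Ints_imp_not_nonpos_Ints[OF nI])
    have "Beta ?s (1/2) = (?s + 1/2) / ?s * Beta (?s + 1) (1/2)"
      by (rule Beta_half_minus1[OF s])
    also have "(?s + 1/2) / ?s = (- (?s + 1/2)) / (- ?s)" by (simp only: minus_divide_divide)
    also have "- (?s + 1/2) = t + of_nat n" by (simp add: t_def)
    also have "- ?s = t + of_nat n + 1/2" by (simp add: t_def)
    also have "?s + 1 = a - of_nat n" by simp
    finally show ?thesis .
  qed
  have step_v: "Beta (t + of_nat (Suc n)) (1/2) = (t + of_nat n) / (t + of_nat n + 1/2) * Beta (t + of_nat n) (1/2)"
    if "n \<ge> k" for n
  proof -
    have re: "Re (t + of_nat n) > 0" using k that by simp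
    hence nz: "t + of_nat n + 1/2 \<noteq> 0" by (auto simp: complex_eq_iff)
    show ?thesis
      using Beta_half_plus1[OF Re_pos_not_nonpos_Ints[OF re]] nz by (simp add: field_simps)
  qed
  have nz: "Beta (t + of_nat k) (1/2) \<noteq> 0"
  proof -
    have "t + of_nat k \<notin> \<int>\<^sub>\<le>\<^sub>0" "t + of_nat k + 1/2 \<notin> \<int>\<^sub>\<le>\<^sub>0" "1/2 \<notin> (\<int>\<^sub>\<le>\<^sub>0 :: complex set)"
      using k by (auto intro!: Re_pos_not_nonpos_Ints)
    thus ?thesis by (simp add: Beta_def Gamma_eq_zero_iff)
  qed
  define c where "c = Beta (a - of_nat k) (1/2) / Beta (t + of_nat k) (1/2)"
  have eq: "Beta (a - of_nat n) (1/2) = c * Beta (t + of_nat n) (1/2)" if "n \<ge> k" for n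
    using that
  proof (induction n rule: nat_induct_at_least)
    case base
    show ?case using nz by (simp add: c_def)
  next
    case (Suc n)
    show ?case unfolding step_u step_v[OF Suc.hyps(1)] Suc.IH by simp
  qed
  have A: "(\<lambda>n. norm c * norm (Beta (t + of_nat n) (1/2))) \<in> O(\<lambda>n. 1 * real n powr (-1/2))"
    by (intro landau_o.big.mult norm_Beta_half_bigo) simp
  have B: "\<forall>\<^sub>F n in sequentially. norm c * norm (Beta (t + of_nat n) (1/2)) = norm (Beta (a - of_nat n) (1/2))"
    using eventually_ge_at_top[of k] by eventually_elim (simp add: eq norm_mult)
  show ?thesis using A landau_o.big.in_cong[OF B] by (simp only: mult_1)
qed

text \<open>A difference gains the factor 1 / (s + 1/2), whence the exponent -3/2 in the step
  bounds.\<close>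

lemma Beta_half_diff:
  fixes s :: complex
  assumes "s \<notin> \<int>\<^sub>\<le>\<^sub>0" "s + 1/2 \<noteq> 0"
  shows "Beta s (1/2) - Beta (s + 1) (1/2) = Beta s (1/2) * inverse (s + 1/2) * (1/2)"
proof -
  have "Beta (s + 1) (1/2) = s * Beta s (1/2) / (s + 1/2)"
    using Beta_half_plus1[OF assms(1)] assms(2) by (simp add: field_simps)
  moreover have "s / (s + 1/2) = 1 - inverse (s + 1/2) * (1/2)"
    using assms(2) by (simp add: field_simps)
  hence "s * b / (s + 1/2) = b - b * inverse (s + 1/2) * (1/2)" for b
    by (metis (no_types, opaque_lifting) mult.assoc mult.commute mult.right_neutral right_diff_distrib times_divide_eq_right)
  ultimately show ?thesis by simp
qed

text \<open>For Q = 0 convergence rests on the oscillation of y^n and bounded variation of F; for Q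
  > 0 the factor 1 / z^Q makes it absolute.\<close>

lemma summable_twisted_over_power:
  fixes y :: complex
  assumes "norm y = 1" "Q > 0 \<or> y \<noteq> 1"
    and F: "(\<lambda>n. norm (F n)) \<in> O(\<lambda>n. real n powr (-1/2))"
    and dF: "(\<lambda>n. norm (F n - F (Suc n))) \<in> O(\<lambda>n. real n powr (-3/2))"
    and z: "(\<lambda>n. norm (inverse (z n))) \<in> O(\<lambda>n. real n powr (-1))"
  shows "summable (\<lambda>n. y ^ n * (F n * inverse (z n) ^ Q))"
proof (cases "Q = 0")
  case True
  thus ?thesis using summable_twisted_bigo[OF assms(1) _ F dF] assms(2) by simp
next
  case False
  have "(\<lambda>n. norm (F n) * norm (inverse (z n) ^ Q)) \<in> O(\<lambda>n. real n powr (-1/2) * real n powr (-1))"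
    using False by (intro landau_o.big.mult F power_bigo z) simp
  moreover have "real n powr (-1/2) * real n powr (-1) = real n powr (-3/2)" for n
    by (subst powr_add [symmetric]) simp
  ultimately have "(\<lambda>n. norm (F n * inverse (z n) ^ Q)) \<in> O(\<lambda>n. real n powr (-3/2))"
    by (simp only: norm_mult)
  thus ?thesis by (rule summable_power_mult_bigo[OF assms(1)])
qed

text \<open>Lets 1 / z play the role of F in \<open>summable_twisted_over_power\<close>, so that
  order Q + 1 is read as F / z^Q. The exponents are weakened to those of the Beta function.\<close>

lemma inverse_step_bigo:
  fixes z :: "nat \<Rightarrow> complex"
  assumes "\<And>n. z n \<noteq> 0" "\<And>n. norm (z (Suc n) - z n) = 1"
    and "(\<lambda>n. norm (inverse (z n))) \<in> O(\<lambda>n. real n powr (-1))"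
    and "(\<lambda>n. norm (inverse (z (Suc n)))) \<in> O(\<lambda>n. real n powr (-1))"
  shows "(\<lambda>n. norm (inverse (z n))) \<in> O(\<lambda>n. real n powr (-1/2))"
    and "(\<lambda>n. norm (inverse (z n) - inverse (z (Suc n)))) \<in> O(\<lambda>n. real n powr (-3/2))"
proof -
  have "(\<lambda>n. real n powr (-1)) \<in> O(\<lambda>n. real n powr (-1/2))" by real_asymp
  with assms(3) show "(\<lambda>n. norm (inverse (z n))) \<in> O(\<lambda>n. real n powr (-1/2))"
    by (rule landau_o.big.trans)
  have "inverse (z n) - inverse (z (Suc n)) = (z (Suc n) - z n) * (inverse (z n) * inverse (z (Suc n)))" for n
    using assms(1)[of n] assms(1)[of "Suc n"] by (simp add: field_simps)
  hence "norm (inverse (z n) - inverse (z (Suc n))) = norm (inverse (z n)) * norm (inverse (z (Suc n)))" for n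
    by (simp only: norm_mult assms(2) mult_1)
  moreover have "(\<lambda>n. norm (inverse (z n)) * norm (inverse (z (Suc n)))) \<in> O(\<lambda>n. real n powr (-1) * real n powr (-1))"
    by (intro landau_o.big.mult assms)
  moreover have "(\<lambda>n. real n powr (-1) * real n powr (-1)) \<in> O(\<lambda>n. real n powr (-3/2))" by real_asymp
  ultimately show "(\<lambda>n. norm (inverse (z n) - inverse (z (Suc n)))) \<in> O(\<lambda>n. real n powr (-3/2))"
    using landau_o.big.trans by (simp only:) blast
qed

lemma Beta_half_step_bigo:
  "(\<lambda>n. norm (Beta (a + of_nat n) (1/2 :: complex) - Beta (a + of_nat (Suc n)) (1/2))) \<in> O(\<lambda>n. real n powr (-3/2))"
  if a: "a \<notin> \<int>"
proof -
  have A: "(\<lambda>n. norm (Beta (a + of_nat n) (1/2 :: complex)) * norm (inverse (a + 1/2 + of_nat n)) * norm (1/2 :: complex))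
      \<in> O(\<lambda>n. real n powr (-1/2) * real n powr (-1) * 1)"
    by (intro landau_o.big.mult norm_Beta_half_bigo norm_inverse_shift_bigo) simp
  have B: "\<forall>\<^sub>F n in sequentially. norm (Beta (a + of_nat n) (1/2 :: complex)) * norm (inverse (a + 1/2 + of_nat n)) * norm (1/2 :: complex)
      = norm (Beta (a + of_nat n) (1/2 :: complex) - Beta (a + of_nat (Suc n)) (1/2))"
    using eventually_real_ge[of "2 * norm (a + 1/2) + 1"]
  proof eventually_elim
    case (elim n)
    have "a + of_nat n \<notin> \<int>" using a by (metis Ints_diff Ints_of_nat add_diff_cancel_right')
    hence s: "a + of_nat n \<notin> \<int>\<^sub>\<le>\<^sub>0" by (rule not_Ints_imp_not_nonpos_Ints)
    have "norm (a + 1/2 + of_nat n) \<ge> real n / 2" using elim by (intro norm_shift_ge) simp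
    moreover have "real n > 0" using elim norm_ge_zero[of "a + 1/2"] by linarith
    ultimately have nz': "a + 1/2 + of_nat n \<noteq> 0" by auto
    have e: "a + 1/2 + of_nat n = a + of_nat n + 1/2" "a + of_nat (Suc n) = a + of_nat n + 1"
      by (simp_all add: add_ac)
    have nz: "a + of_nat n + 1/2 \<noteq> 0" using nz' unfolding e(1) .
    show ?case unfolding e Beta_half_diff[OF s nz] norm_mult ..
  qed
  have "(\<lambda>n. real n powr (-1/2) * real n powr (-1) * 1) \<in> O(\<lambda>n. real n powr (-3/2))" by real_asymp
  with A show ?thesis using landau_o.big.in_cong[OF B] landau_o.big.trans by blast
qed

lemma Beta_half_step_neg_bigo:
  "(\<lambda>n. norm (Beta (a - of_nat n) (1/2 :: complex) - Beta (a - of_nat (Suc n)) (1/2))) \<in> O(\<lambda>n. real n powr (-3/2))"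
  if a: "a \<notin> \<int>"
proof -
  have a1: "a - 1 \<notin> \<int>" using a by (metis Ints_1 Ints_add diff_add_cancel)
  have A: "(\<lambda>n. norm (Beta (a - 1 - of_nat n) (1/2 :: complex)) * norm (inverse (a - 1/2 - of_nat n)) * norm (1/2 :: complex))
      \<in> O(\<lambda>n. real n powr (-1/2) * real n powr (-1) * 1)"
    by (intro landau_o.big.mult norm_Beta_half_neg_bigo norm_inverse_shift_neg_bigo a1) simp
  have B: "\<forall>\<^sub>F n in sequentially. norm (Beta (a - 1 - of_nat n) (1/2 :: complex)) * norm (inverse (a - 1/2 - of_nat n)) * norm (1/2 :: complex)
      = norm (Beta (a - of_nat n) (1/2 :: complex) - Beta (a - of_nat (Suc n)) (1/2))"
    using eventually_real_ge[of "2 * norm (1/2 - a) + 1"]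
  proof eventually_elim
    case (elim n)
    have "a - 1 - of_nat n \<notin> \<int>" using a1 by (metis Ints_add Ints_of_nat diff_add_cancel)
    hence s: "a - 1 - of_nat n \<notin> \<int>\<^sub>\<le>\<^sub>0" by (rule not_Ints_imp_not_nonpos_Ints)
    have "norm (1/2 - a + of_nat n) \<ge> real n / 2" using elim by (intro norm_shift_ge) simp
    moreover have "real n > 0" using elim norm_ge_zero[of "1/2 - a"] by linarith
    ultimately have nz': "1/2 - a + of_nat n \<noteq> 0" by auto
    have "a - 1 - of_nat n + 1/2 = - (1/2 - a + of_nat n)" by simp
    with nz' have nz: "a - 1 - of_nat n + 1/2 \<noteq> 0" by (simp only: neg_equal_0_iff_equal) simp
    have e: "a - 1/2 - of_nat n = a - 1 - of_nat n + 1/2" "a - of_nat (Suc n) = a - 1 - of_nat n"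
      "a - of_nat n = a - 1 - of_nat n + 1"
      by simp_all
    show ?case unfolding e(1,2) norm_mult [symmetric] Beta_half_diff[OF s nz, symmetric] norm_minus_commute[of "Beta (a - 1 - of_nat n) (1/2)"]
      by (simp only: e(3) [symmetric])
  qed
  have "(\<lambda>n. real n powr (-1/2) * real n powr (-1) * 1) \<in> O(\<lambda>n. real n powr (-3/2))" by real_asymp
  with A show ?thesis using landau_o.big.in_cong[OF B] landau_o.big.trans by blast
qed

lemma bi_summable_twisted:
  fixes f :: "int \<Rightarrow> complex" and x :: complex
  assumes "summable (\<lambda>n. inverse x ^ n * f (int n))" "summable (\<lambda>n. x ^ n * f (- int n))"
  shows "bi_summable (\<lambda>k. x powi (- k) * f k)"
proof -
  have "x powi (- int n) * f (int n) = inverse x ^ n * f (int n)" for n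
    by (simp add: power_int_minus power_inverse)
  moreover have "x powi (- (- int (Suc n))) * f (- int (Suc n)) = x ^ Suc n * f (- int (Suc n))" for n
    by (simp only: minus_minus power_int_of_nat)
  moreover have "summable (\<lambda>n. x ^ Suc n * f (- int (Suc n)))"
    using assms(2) summable_Suc_iff[of "\<lambda>n. x ^ n * f (- int n)"] by simp
  ultimately show ?thesis unfolding bi_summable_def using assms(1) by (simp only: simp_thms)
qed

lemma bi_summable_Beta_half:
  assumes x: "norm x = 1" and a: "a \<notin> \<int>" and Q: "Q > 0 \<or> x \<noteq> 1"
  shows "bi_summable (\<lambda>k. x powi (- k) * (Beta (of_int k + a) (1/2) * inverse (of_int k + a) ^ Q))"
proof (rule bi_summable_twisted)
  have x': "norm (inverse x) = 1" and Q': "Q > 0 \<or> inverse x \<noteq> 1" using x Q by (auto simp: norm_inverse)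
  have "summable (\<lambda>n. inverse x ^ n * (Beta (a + of_nat n) (1/2) * inverse (a + of_nat n) ^ Q))"
    by (intro summable_twisted_over_power x' Q' norm_Beta_half_bigo Beta_half_step_bigo norm_inverse_shift_bigo a)
  thus "summable (\<lambda>n. inverse x ^ n * (Beta (of_int (int n) + a) (1/2) * inverse (of_int (int n) + a) ^ Q))"
    by (simp only: of_int_of_nat_eq add.commute)
  have "summable (\<lambda>n. x ^ n * (Beta (a - of_nat n) (1/2) * inverse (a - of_nat n) ^ Q))"
    by (intro summable_twisted_over_power x Q norm_Beta_half_neg_bigo Beta_half_step_neg_bigo norm_inverse_shift_neg_bigo a)
  thus "summable (\<lambda>n. x ^ n * (Beta (of_int (- int n) + a) (1/2) * inverse (of_int (- int n) + a) ^ Q))"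
    by (simp only: of_int_of_nat_eq of_int_minus uminus_add_conv_diff)
qed

section \<open>Convergence of the Li series and of the central binomial series\<close>

lemma summable_Li:
  fixes x a :: complex
  assumes x: "norm x = 1" and a: "a \<notin> \<int>" and Q: "Q > 0 \<or> x \<noteq> 1"
  shows "summable (\<lambda>n. inverse x ^ n * inverse (a + of_nat n) ^ Suc Q)"
    and "summable (\<lambda>n. x ^ n * inverse (a - of_nat n) ^ Suc Q)"
proof -
  have x': "norm (inverse x) = 1" and Q': "Q > 0 \<or> inverse x \<noteq> 1" using x Q by (auto simp: norm_inverse)
  have nz: "a + of_nat n \<noteq> 0" "a - of_nat n \<noteq> 0" for n
    using a by (metis Ints_minus Ints_of_nat add_eq_0_iff2 eq_iff_diff_eq_0)+
  have 1: "(\<lambda>n. norm (inverse (a + of_nat (Suc n)))) \<in> O(\<lambda>n. real n powr (-1))"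
    using norm_inverse_shift_bigo[of "a + 1"] by (simp add: add_ac)
  have 2: "(\<lambda>n. norm (inverse (a - of_nat (Suc n)))) \<in> O(\<lambda>n. real n powr (-1))"
    using norm_inverse_shift_neg_bigo[of "a - 1"] by (simp add: diff_diff_eq)
  have s1: "norm ((a + of_nat (Suc n)) - (a + of_nat n)) = 1" and s2: "norm ((a - of_nat (Suc n)) - (a - of_nat n)) = 1" for n
    by simp_all
  show "summable (\<lambda>n. inverse x ^ n * inverse (a + of_nat n) ^ Suc Q)"
    unfolding power_Suc
    by (intro summable_twisted_over_power x' Q' inverse_step_bigo nz 1 norm_inverse_shift_bigo s1)
  show "summable (\<lambda>n. x ^ n * inverse (a - of_nat n) ^ Suc Q)"
    unfolding power_Suc
    by (intro summable_twisted_over_power x Q inverse_step_bigo nz 2 norm_inverse_shift_neg_bigo s2)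
qed

lemma cbinom_step_bigo:
  "(\<lambda>n. norm (complex_of_real (cbinom n) - of_real (cbinom (Suc n)))) \<in> O(\<lambda>n. real n powr (-3/2))"
proof -
  have "complex_of_real (cbinom n) - of_real (cbinom (Suc n)) = of_real (cbinom n) * (inverse (1 + of_nat n) * (1/2))" for n
  proof -
    have "cbinom n - cbinom (Suc n) = cbinom n * (inverse (1 + real n) * (1/2))"
      by (simp add: cbinom_Suc field_simps)
    from arg_cong[OF this, of complex_of_real] show ?thesis by simp
  qed
  hence e: "norm (complex_of_real (cbinom n) - of_real (cbinom (Suc n))) = cbinom n * (norm (inverse (1 + of_nat n :: complex)) * (1/2))" for n
    using cbinom_pos[of n] by (simp only: norm_mult norm_of_real abs_of_pos) simp
  have "(\<lambda>n. cbinom n * (norm (inverse (1 + of_nat n :: complex)) * (1/2))) \<in> O(\<lambda>n. real n powr (-1/2) * (real n powr (-1) * 1))"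
    by (intro landau_o.big.mult cbinom_bigo norm_inverse_shift_bigo) simp
  moreover have "(\<lambda>n. real n powr (-1/2) * (real n powr (-1) * 1)) \<in> O(\<lambda>n. real n powr (-3/2))" by real_asymp
  ultimately show ?thesis
    unfolding e by (rule landau_o.big.trans)
qed

lemma summable_cbinom_twisted:
  fixes x :: complex
  assumes "norm x = 1" "Q > 0 \<or> x \<noteq> 1"
  shows "summable (\<lambda>n. x ^ n * (of_real (cbinom n) * inverse (of_nat n) ^ Q))"
proof (rule summable_twisted_over_power[OF assms _ cbinom_step_bigo])
  show "(\<lambda>n. norm (complex_of_real (cbinom n))) \<in> O(\<lambda>n. real n powr (-1/2))"
    using cbinom_bigo cbinom_pos by (simp add: abs_of_pos)
  show "(\<lambda>n. norm (inverse (of_nat n :: complex))) \<in> O(\<lambda>n. real n powr (-1))"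
    using norm_inverse_shift_bigo[of 0] by simp
qed

section \<open>Evaluation of the two-sided series\<close>

lemma bi_summable_Li:
  assumes x: "norm x = 1" and a: "a \<notin> \<int>" and Q: "Q > 0 \<or> x \<noteq> 1"
  shows "bi_summable (\<lambda>k. x powi (- k) * inverse (of_int k + a) ^ Suc Q)"
proof (rule bi_summable_twisted)
  show "summable (\<lambda>n. inverse x ^ n * inverse (of_int (int n) + a) ^ Suc Q)"
    using summable_Li(1)[OF assms] by (simp only: of_int_of_nat_eq add.commute)
  show "summable (\<lambda>n. x ^ n * inverse (of_int (- int n) + a) ^ Suc Q)"
    using summable_Li(2)[OF assms] by (simp only: of_int_of_nat_eq of_int_minus uminus_add_conv_diff)
qed

text \<open>The nonnegative indices start at 0 but those of Li at 1, which explains the factor x. At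
  k = -n the denominator is (a - n)^(Q+1) = (-1)^(Q+1) (n - a)^(Q+1), which explains the
  sign.\<close>

lemma bi_suminf_Li:
  assumes x: "norm x = 1" and a: "a \<notin> \<int>" and Q: "Q > 0 \<or> x \<noteq> 1"
  shows "bi_suminf (\<lambda>k. x powi (- k) * inverse (of_int k + a) ^ Suc Q) = cyc_Li_comb Q x a"
proof -
  have x0: "x \<noteq> 0" using x by auto
  have "(\<Sum>n. x powi (- int n) * inverse (of_int (int n) + a) ^ Suc Q) = x * cyc_Li (Q + 1) (inverse x) a"
  proof -
    have "x powi (- int n) * inverse (of_int (int n) + a) ^ Suc Q = inverse x ^ n * inverse (a + of_nat n) ^ Suc Q" for n
      by (simp add: power_int_minus power_inverse add.commute)
    moreover have "inverse x ^ Suc n / (of_nat (Suc n) + (a - 1)) ^ (Q + 1) =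
        inverse x * (inverse x ^ n * inverse (a + of_nat n) ^ Suc Q)" for n
    proof -
      have "of_nat (Suc n) + (a - 1) = a + of_nat n" by simp
      thus ?thesis by (simp only: divide_inverse power_inverse [symmetric] Suc_eq_plus1 [symmetric] power_Suc [of "inverse x"] mult.assoc)
    qed
    ultimately show ?thesis
      unfolding cyc_Li_def using suminf_mult[OF summable_Li(1)[OF assms], of "inverse x"] x0
      by (simp del: power_Suc)
  qed
  moreover have "(\<Sum>n. x powi (- (- int (Suc n))) * inverse (of_int (- int (Suc n)) + a) ^ Suc Q) =
      - ((-1) ^ Q * cyc_Li (Q + 1) x (1 - a))"
  proof -
    let ?t = "\<lambda>n. x powi (- (- int (Suc n))) * inverse (of_int (- int (Suc n)) + a) ^ Suc Q"
    have "?t n = x ^ Suc n * inverse (a - of_nat (Suc n)) ^ Suc Q" for n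
      by (simp only: minus_minus power_int_of_nat of_int_of_nat_eq of_int_minus uminus_add_conv_diff)
    moreover have "summable (\<lambda>n. x ^ Suc n * inverse (a - of_nat (Suc n)) ^ Suc Q)"
      using summable_Li(2)[OF assms] by (subst summable_Suc_iff)
    ultimately have sm: "summable ?t" by (simp only:)
    have "x ^ Suc n / (of_nat (Suc n) + (1 - a - 1)) ^ (Q + 1) = (- ((-1) ^ Q)) * ?t n" for n
    proof -
      have "of_nat (Suc n) + (1 - a - 1) = - (a - of_nat (Suc n))" by simp
      moreover have "inverse ((- u) ^ (Q + 1)) = (-1) ^ (Q + 1) * inverse u ^ (Q + 1)" for u :: complex
        by (simp only: power_inverse [symmetric] inverse_minus_eq power_minus [of "inverse u"])
      ultimately have "inverse ((of_nat (Suc n) + (1 - a - 1)) ^ (Q + 1)) = (-1) ^ (Q + 1) * inverse (a - of_nat (Suc n)) ^ (Q + 1)"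
        by (simp only:)
      thus ?thesis
        by (simp only: divide_inverse minus_minus power_int_of_nat of_int_of_nat_eq of_int_minus uminus_add_conv_diff) simp
    qed
    hence "cyc_Li (Q + 1) x (1 - a) = (- ((-1) ^ Q)) * suminf ?t"
      unfolding cyc_Li_def using suminf_mult[OF sm, of "- ((-1) ^ Q)"] by (simp only:)
    hence "(-1) ^ Q * cyc_Li (Q + 1) x (1 - a) = - (((-1) ^ Q * (-1) ^ Q) * suminf ?t)" by simp
    also have "(-1) ^ Q * (-1) ^ Q = (1 :: complex)" by (simp add: power_mult_distrib [symmetric])
    finally show ?thesis by simp
  qed
  ultimately have "bi_suminf (\<lambda>k. x powi (- k) * inverse (of_int k + a) ^ Suc Q) =
      x * cyc_Li (Q + 1) (inverse x) a - (-1) ^ Q * cyc_Li (Q + 1) x (1 - a)"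
    unfolding bi_suminf_def by (simp only:) simp
  moreover have "\<not> (Q = 0 \<and> x = 1)" using Q by auto
  ultimately show ?thesis unfolding cyc_Li_comb_def by (simp only: if_False)
qed

lemma cyc_Li_comb_0: "cyc_Li_comb 0 x a = - cyc_Li1_diff x a"
  by (simp add: cyc_Li_comb_def cyc_Li1_diff_def)

lemma bisum_Li_tendsto:
  assumes x: "norm x = 1" and a: "a \<notin> \<int>"
  shows "(\<lambda>N. bisum N (\<lambda>k. x powi (- k) * inverse (of_int k + a) ^ Suc Q)) \<longlonglongrightarrow> cyc_Li_comb Q x a"
proof (cases "Q > 0 \<or> x \<noteq> 1")
  case True
  thus ?thesis
    using bisum_tendsto_bi_suminf[OF bi_summable_Li[OF x a True]] bi_suminf_Li[OF x a True] by (simp only:)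
next
  case False
  hence Q: "Q = 0" and x1: "x = 1" by auto
  \<comment> \<open>The window pairs n with -(n + 1). The paired terms are - t n = O(n^(-2)), and
    their sum is the reading of the order-one combination at x = 1.\<close>
  define t where "t n = inverse (of_nat (Suc n) - a) - inverse (of_nat n + a)" for n
  have nz: "of_nat n + a \<noteq> 0" "of_nat n - a \<noteq> 0" for n
    using a by (metis Ints_minus Ints_of_nat add_eq_0_iff eq_iff_diff_eq_0)+
  have te: "t n = (2 * a - 1) * (inverse (1 - a + of_nat n) * inverse (a + of_nat n))" for n
  proof -
    have "1 - a + of_nat n \<noteq> 0" "a + of_nat n \<noteq> 0"
      using nz(2)[of "Suc n"] nz(1)[of n] by (simp_all add: add_ac algebra_simps)
    moreover have "of_nat (Suc n) - a = 1 - a + of_nat n" by simp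
    ultimately show ?thesis unfolding t_def by (simp add: field_simps)
  qed
  have "summable (\<lambda>n. norm (t n))"
  proof (rule summable_bigo_powr)
    have "(\<lambda>n. norm (2 * a - 1) * (norm (inverse (1 - a + of_nat n)) * norm (inverse (a + of_nat n)))) \<in>
        O(\<lambda>n. 1 * (real n powr (-1) * real n powr (-1)))"
      by (intro landau_o.big.mult norm_inverse_shift_bigo) simp
    moreover have "(\<lambda>n. 1 * (real n powr (-1) * real n powr (-1))) \<in> O(\<lambda>n. real n powr (-2))" by real_asymp
    ultimately show "(\<lambda>n. norm (t n)) \<in> O(\<lambda>n. real n powr (-2))"
      unfolding te norm_mult by (rule landau_o.big.trans)
  qed simp
  hence "summable t" by (rule summable_norm_cancel)
  hence "(\<lambda>N. - (\<Sum>n<N. t n)) \<longlonglongrightarrow> - suminf t"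
    by (intro tendsto_minus summable_LIMSEQ)
  moreover have "- (\<Sum>n<N. t n) = bisum N (\<lambda>k. x powi (- k) * inverse (of_int k + a) ^ Suc Q)" for N
  proof -
    have "- t n = inverse (of_int (int n) + a) + inverse (of_int (- int (Suc n)) + a)" for n
    proof -
      have "of_int (- int (Suc n)) + a = - (of_nat (Suc n) - a)" by simp
      thus ?thesis by (simp only: inverse_minus_eq) (simp add: t_def)
    qed
    thus ?thesis unfolding bisum_eq by (simp add: Q x1 sum.distrib [symmetric] sum_negf [symmetric])
  qed
  moreover have "cyc_Li1_diff x a = suminf t"
    unfolding cyc_Li1_diff_def t_def using x1 by (simp add: inverse_eq_divide)
  ultimately show ?thesis by (simp add: cyc_Li_comb_0 Q)
qed

lemma bisum_shift: "bisum N (\<lambda>k. f (k + 1)) = bisum N f + f (int N) - f (- int N)"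
proof (induction N)
  case (Suc N)
  have "bisum (Suc N) (\<lambda>k. f (k + 1)) = bisum N (\<lambda>k. f (k + 1)) + f (int N + 1) + f (- int (Suc N) + 1)"
    unfolding bisum_eq by (simp only: sum.lessThan_Suc) simp
  moreover have "bisum (Suc N) f = bisum N f + f (int N) + f (- int (Suc N))"
    unfolding bisum_eq by (simp only: sum.lessThan_Suc) simp
  moreover have "int N + 1 = int (Suc N)" "- int (Suc N) + 1 = - int N" by simp_all
  ultimately show ?case using Suc.IH by (simp only:) simp
qed (simp add: bisum_def)

lemma twisted_sum_Li:
  assumes x: "norm x = 1" and a: "a \<notin> \<int>"
  shows "twisted_sum x a (cyc_Li_comb 0 x a)"
proof
  show "(\<lambda>N. bisum N (\<lambda>k. x powi (- k) / (of_int k + a))) \<longlonglongrightarrow> cyc_Li_comb 0 x a"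
    using bisum_Li_tendsto[OF x a, of 0] by (simp add: divide_inverse)
qed (use assms in auto)

lemma bi_suminf_Beta_half_pos:
  assumes x: "norm x = 1" and a: "a \<notin> \<int>" and Q: "Q > 0"
  shows "bi_suminf (\<lambda>k. x powi (- k) * (Beta (of_int k + a) (1/2) * inverse (of_int k + a) ^ Q)) =
    (\<Sum>i\<le>Q. fps_nth central_gf_fps i * cyc_Li_comb (Q - i) x a) +
    (-1) ^ Q * cyc_Li_comb 0 x a * (\<Sum>n. x ^ Suc n * (of_real (cbinom (Suc n)) * inverse (of_nat (Suc n)) ^ Q))"
proof -
  let ?F = "\<lambda>k. x powi (- k) * (Beta (of_int k + a) (1/2) * inverse (of_int k + a) ^ Q)"
  let ?h = "\<lambda>n. x ^ n * (complex_of_real (cbinom n) * inverse (of_nat n) ^ Q)"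
  interpret twisted_sum x a "cyc_Li_comb 0 x a" by (rule twisted_sum_Li[OF x a])
  \<comment> \<open>At m = 0 both sides vanish: Q > 0 and \<open>inverse 0 = 0\<close>.\<close>
  have "(\<Sum>m. tail_coeff Q m * x ^ m) = (\<Sum>m. (-1) ^ Q * ?h m)"
    by (intro suminf_cong) (simp add: tail_coeff_def Q divide_inverse power_inverse)
  also have "\<dots> = (-1) ^ Q * suminf ?h"
    using Q by (intro suminf_mult summable_cbinom_twisted x) simp
  also have "suminf ?h = (\<Sum>n. ?h (Suc n))"
    using suminf_split_head[of ?h] Q summable_cbinom_twisted[OF x, of Q] by simp
  finally have r: "(\<Sum>m. tail_coeff Q m * x ^ m) = (-1) ^ Q * (\<Sum>n. ?h (Suc n))" .
  have F: "?F k = (\<Sum>i\<le>Q. fps_nth central_gf_fps i * (x powi (- k) * inverse (of_int k + a) ^ Suc (Q - i))) +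
      x powi (- k) * tail_frac Q (of_int k + a)" for k
  proof -
    have "of_int k + a \<notin> \<int>" using a by (metis Ints_diff Ints_of_int add_diff_cancel_left')
    from Beta_half_over_power[OF not_Ints_imp_not_nonpos_Ints[OF this], of Q]
    have "Beta (of_int k + a) (1/2) * inverse (of_int k + a) ^ Q =
        (\<Sum>i\<le>Q. fps_nth central_gf_fps i * inverse (of_int k + a) ^ (Suc Q - i)) + tail_frac Q (of_int k + a)"
      by (simp only: divide_inverse power_inverse)
    moreover have "(\<Sum>i\<le>Q. fps_nth central_gf_fps i * inverse (of_int k + a) ^ (Suc Q - i)) =
        (\<Sum>i\<le>Q. fps_nth central_gf_fps i * inverse (of_int k + a) ^ Suc (Q - i))"
      by (intro sum.cong refl) (simp add: Suc_diff_le del: power_Suc)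
    ultimately have "Beta (of_int k + a) (1/2) * inverse (of_int k + a) ^ Q =
        (\<Sum>i\<le>Q. fps_nth central_gf_fps i * inverse (of_int k + a) ^ Suc (Q - i)) + tail_frac Q (of_int k + a)"
      by (simp only:)
    thus ?thesis by (simp only: distrib_left sum_distrib_left mult.left_commute)
  qed
  have "bisum N ?F = (\<Sum>i\<le>Q. fps_nth central_gf_fps i * bisum N (\<lambda>k. x powi (- k) * inverse (of_int k + a) ^ Suc (Q - i))) +
      bisum N (\<lambda>k. x powi (- k) * tail_frac Q (of_int k + a))" for N
    unfolding F bisum_def sum.distrib sum_distrib_left
    by (subst sum.swap) (rule refl)
  moreover have "(\<lambda>N. (\<Sum>i\<le>Q. fps_nth central_gf_fps i * bisum N (\<lambda>k. x powi (- k) * inverse (of_int k + a) ^ Suc (Q - i))) +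
      bisum N (\<lambda>k. x powi (- k) * tail_frac Q (of_int k + a))) \<longlonglongrightarrow>
     (\<Sum>i\<le>Q. fps_nth central_gf_fps i * cyc_Li_comb (Q - i) x a) + cyc_Li_comb 0 x a * (\<Sum>m. tail_coeff Q m * x ^ m)"
    by (intro tendsto_add tendsto_sum tendsto_mult tendsto_const bisum_Li_tendsto x a
          bisum_partial_fractions summable_tail_coeff_harm Q tail_frac_sums)
  ultimately have "(\<lambda>N. bisum N ?F) \<longlonglongrightarrow>
     (\<Sum>i\<le>Q. fps_nth central_gf_fps i * cyc_Li_comb (Q - i) x a) + cyc_Li_comb 0 x a * (\<Sum>m. tail_coeff Q m * x ^ m)"
    by (simp only:)
  moreover have "(\<lambda>N. bisum N ?F) \<longlonglongrightarrow> bi_suminf ?F"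
    using Q by (intro bisum_tendsto_bi_suminf bi_summable_Beta_half x a) simp
  ultimately have "bi_suminf ?F = (\<Sum>i\<le>Q. fps_nth central_gf_fps i * cyc_Li_comb (Q - i) x a) +
      cyc_Li_comb 0 x a * (\<Sum>m. tail_coeff Q m * x ^ m)"
    using LIMSEQ_unique by blast
  thus ?thesis unfolding r by (simp only: mult_ac)
qed

text \<open>
  For \<open>Q = 0\<close> the coefficients \<open>cbinom m\<close> are not absolutely summable, so the dominated convergence
  argument is applied to the differences \<open>B(s) - B(s + 1)\<close>; this multiplies the sum by \<open>1 - x\<close>.
\<close>

lemma bi_suminf_Beta_half_0:
  assumes x: "norm x = 1" and a: "a \<notin> \<int>" and x1: "x \<noteq> 1"
  shows "bi_suminf (\<lambda>k. x powi (- k) * Beta (of_int k + a) (1/2)) =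
    cyc_Li_comb 0 x a * (\<Sum>n. x ^ n * of_real (cbinom n))"
proof -
  let ?F = "\<lambda>k. x powi (- k) * Beta (of_int k + a) (1/2)"
  \<comment> \<open>The residues of B(s) - B(s + 1): the poles of the second function start at -1,
    so it contributes b_(m-1) at -m. These differences decay like m^(-3/2).\<close>
  define r :: "nat \<Rightarrow> complex" where
    "r m = of_real (cbinom m) - (case m of 0 \<Rightarrow> 0 | Suc j \<Rightarrow> of_real (cbinom j))" for m
  interpret twisted_sum x a "cyc_Li_comb 0 x a" by (rule twisted_sum_Li[OF x a])
  have r: "summable (\<lambda>m. norm (r m) * (1 + harm m))"
  proof -
    have "summable (\<lambda>m. norm (norm (r (Suc m)) * (1 + harm (Suc m))))"
    proof (rule summable_bigo_powr)
      have 1: "(\<lambda>m. norm (r (Suc m))) \<in> O(\<lambda>m. real m powr (-3/2))"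
        using cbinom_step_bigo by (simp add: r_def norm_minus_commute)
      have "1 + harm (Suc m) \<le> 2 * (1 + harm m :: real)" for m
      proof -
        have "inverse (real (Suc m)) \<le> 1" by (simp add: field_simps)
        thus ?thesis using harm_nonneg[of m, where ?'a = real] by (simp add: harm_Suc)
      qed
      hence "(\<lambda>m. 1 + harm (Suc m) :: real) \<in> O(\<lambda>m. 1 + harm m)"
        by (intro bigoI[of _ 2] always_eventually allI) (simp add: abs_of_nonneg harm_nonneg)
      hence 2: "(\<lambda>m. 1 + harm (Suc m) :: real) \<in> O(\<lambda>m. real m powr (1/4))"
        using harm_bigo by (rule landau_o.big.trans)
      have "(\<lambda>m. norm (r (Suc m)) * (1 + harm (Suc m))) \<in> O(\<lambda>m. real m powr (-3/2) * real m powr (1/4))"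
        by (intro landau_o.big.mult 1 2)
      moreover have "(\<lambda>m. real m powr (-3/2) * real m powr (1/4)) \<in> O(\<lambda>m. real m powr (-5/4))" by real_asymp
      ultimately have "(\<lambda>m. norm (r (Suc m)) * (1 + harm (Suc m))) \<in> O(\<lambda>m. real m powr (-5/4))"
        by (rule landau_o.big.trans)
      thus "(\<lambda>m. norm (norm (r (Suc m)) * (1 + harm (Suc m)))) \<in> O(\<lambda>m. real m powr (-5/4))"
        by (simp only: landau_o.big.norm_iff real_norm_def landau_o.big.abs_in_iff)
    qed simp
    hence "summable (\<lambda>m. norm (r (Suc m)) * (1 + harm (Suc m)))" by (rule summable_norm_cancel)
    thus ?thesis by (subst (asm) summable_Suc_iff)
  qed
  have H: "(\<lambda>m. r m / (of_int k + a + of_nat m)) sums (Beta (of_int k + a) (1/2) - Beta (of_int (k + 1) + a) (1/2))" for k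
  proof -
    have "of_int k + a \<notin> \<int>" "of_int (k + 1) + a \<notin> \<int>" using a by (metis Ints_diff Ints_of_int add_diff_cancel_left')+
    hence n: "of_int k + a \<notin> \<int>\<^sub>\<le>\<^sub>0" "of_int (k + 1) + a \<notin> \<int>\<^sub>\<le>\<^sub>0" by (simp_all only: not_Ints_imp_not_nonpos_Ints not_False_eq_True)
    let ?g = "\<lambda>m. (case m of 0 \<Rightarrow> 0 | Suc j \<Rightarrow> of_real (cbinom j)) / (of_int k + a + of_nat m) :: complex"
    have "(\<lambda>j. ?g (Suc j)) sums Beta (of_int (k + 1) + a) (1/2)"
      using Beta_half_partial_fractions[OF n(2)] by (simp add: add_ac)
    from sums_Suc[OF this] have "?g sums Beta (of_int (k + 1) + a) (1/2)" by simp
    from sums_diff[OF Beta_half_partial_fractions[OF n(1)] this]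
    show ?thesis by (simp only: r_def diff_divide_distrib)
  qed
  have sm: "summable (\<lambda>n. x ^ n * complex_of_real (cbinom n))"
    using summable_cbinom_twisted[OF x, of 0] x1 by simp
  have rsum: "(\<Sum>m. r m * x ^ m) = (1 - x) * (\<Sum>n. x ^ n * of_real (cbinom n))"
  proof -
    let ?T = "\<Sum>n. x ^ n * complex_of_real (cbinom n)"
    let ?g = "\<lambda>m. (case m of 0 \<Rightarrow> 0 | Suc j \<Rightarrow> complex_of_real (cbinom j)) * x ^ m"
    have T: "(\<lambda>n. x ^ n * complex_of_real (cbinom n)) sums ?T" using sm by (rule summable_sums)
    have "(\<lambda>j. ?g (Suc j)) sums (x * ?T)"
      using sums_mult[OF T, of x] by (simp add: mult_ac)
    from sums_Suc[OF this] have "?g sums (x * ?T)" by simp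
    moreover have "(\<lambda>n. complex_of_real (cbinom n) * x ^ n) sums ?T"
      using T by (simp only: mult.commute)
    ultimately have "(\<lambda>m. r m * x ^ m) sums (?T - x * ?T)"
      unfolding r_def left_diff_distrib by (intro sums_diff)
    thus ?thesis by (simp add: sums_iff left_diff_distrib)
  qed
  have bs: "bi_summable ?F"
    using bi_summable_Beta_half[OF x a, of 0] x1 by simp
  have F1: "x powi (- k) * (Beta (of_int k + a) (1/2) - Beta (of_int (k + 1) + a) (1/2)) = ?F k - x * ?F (k + 1)" for k
  proof -
    have "x * x powi (- (k + 1)) = x powi (1 + - (k + 1))"
      by (subst power_int_add) auto
    also have "1 + - (k + 1) = - k" by simp
    finally show ?thesis by (simp only: mult.assoc [symmetric] right_diff_distrib)
  qed
  have F2: "bisum N (\<lambda>k. ?F k - x * ?F (k + 1)) = bisum N ?F - x * (bisum N ?F + ?F (int N) - ?F (- int N))" for N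
    unfolding bisum_shift[of N ?F, symmetric] by (simp add: bisum_def sum_subtractf sum_distrib_left)
  \<comment> \<open>The boundary terms tend to 0 because both halves of the series converge, leaving
    (1 - x) times the two-sided sum. The factor 1 - x also comes out of the series of
    \<open>r\<close> and cancels.\<close>
  have "(\<lambda>N. bisum N ?F - x * (bisum N ?F + ?F (int N) - ?F (- int N))) \<longlonglongrightarrow>
      bi_suminf ?F - x * (bi_suminf ?F + 0 - 0)"
  proof (intro tendsto_diff tendsto_mult tendsto_add tendsto_const bisum_tendsto_bi_suminf bs)
    show "(\<lambda>N. ?F (int N)) \<longlonglongrightarrow> 0"
      using bs unfolding bi_summable_def by (blast intro: summable_LIMSEQ_zero)
    have "(\<lambda>N. ?F (- int (Suc N))) \<longlonglongrightarrow> 0"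
      using bs unfolding bi_summable_def by (blast intro: summable_LIMSEQ_zero)
    thus "(\<lambda>N. ?F (- int N)) \<longlonglongrightarrow> 0"
      by (rule LIMSEQ_imp_Suc)
  qed
  moreover have "(\<lambda>N. bisum N ?F - x * (bisum N ?F + ?F (int N) - ?F (- int N))) \<longlonglongrightarrow>
      cyc_Li_comb 0 x a * (\<Sum>m. r m * x ^ m)"
    using bisum_partial_fractions[OF r H] unfolding F1 F2 .
  ultimately have "bi_suminf ?F - x * (bi_suminf ?F + 0 - 0) = cyc_Li_comb 0 x a * (\<Sum>m. r m * x ^ m)"
    by (rule LIMSEQ_unique)
  hence "(1 - x) * bi_suminf ?F = (1 - x) * (cyc_Li_comb 0 x a * (\<Sum>n. x ^ n * of_real (cbinom n)))"
    unfolding rsum by (simp add: algebra_simps)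
  thus ?thesis using x1 by simp
qed

lemma bi_suminf_Beta_half:
  assumes x: "norm x = 1" and a: "a \<notin> \<int>" and Q: "Q > 0 \<or> x \<noteq> 1"
  shows "bi_suminf (\<lambda>k. x powi (- k) * (Beta (of_int k + a) (1/2) * inverse (of_int k + a) ^ Q)) =
    (\<Sum>i\<le>Q. fps_nth central_gf_fps i * cyc_Li_comb (Q - i) x a) +
    (-1) ^ Q * cyc_Li_comb 0 x a * (\<Sum>n. x ^ Suc n * (of_real (cbinom (Suc n)) * inverse (of_nat (Suc n)) ^ Q))"
proof (cases "Q = 0")
  case True
  hence x1: "x \<noteq> 1" using Q by simp
  have sm: "summable (\<lambda>n. x ^ n * complex_of_real (cbinom n))"
    using summable_cbinom_twisted[OF x, of 0] x1 by simp
  \<comment> \<open>For Q = 0 the pole at 0 is simple like the others; its term n = 0 is the whole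
    polar sum, with coefficient 1 by \<open>central_gf_0\<close>.\<close>
  have "(\<Sum>n. x ^ n * complex_of_real (cbinom n)) = 1 + (\<Sum>n. x ^ Suc n * complex_of_real (cbinom (Suc n)))"
    using suminf_split_head[OF sm] by (simp del: power_Suc)
  thus ?thesis
    using bi_suminf_Beta_half_0[OF x a x1] True by (simp add: central_gf_0 distrib_left del: power_Suc)
next
  case False
  thus ?thesis by (intro bi_suminf_Beta_half_pos x a) simp
qed

theorem theorem2p1:
  fixes x a :: complex and q :: nat
  assumes root_of_unity: "\<exists>m>0. x ^ m = 1"
    and a: "a \<notin> \<int>"
    and q: "q > 0"
    and qx: "(q, x) \<noteq> (1, 1)"
  shows "bi_summable (\<lambda>n. 4 powr (of_int n + a)
           / ((of_int n + a) ^ q * gen_binomial (2 * of_int n + 2 * a) (of_int n + a))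
           * x powi (- n))
    \<and> summable (\<lambda>n. of_nat ((2 * Suc n) choose Suc n)
           / (of_nat (Suc n) ^ (q - 1) * 4 ^ Suc n) * x ^ Suc n)
    \<and> bi_suminf (\<lambda>n. 4 powr (of_int n + a)
           / ((of_int n + a) ^ q * gen_binomial (2 * of_int n + 2 * a) (of_int n + a))
           * x powi (- n))
         - (-1) ^ q * cyc_Li1_diff x a
           * (\<Sum>n. of_nat ((2 * Suc n) choose Suc n)
                / (of_nat (Suc n) ^ (q - 1) * 4 ^ Suc n) * x ^ Suc n)
       = (\<Sum>(k1, k2, k3, k4, k5) \<in> {(k1, k2, k3, k4, k5). k1 + k2 + k3 + k4 + k5 = q - 1}.
            coeff_C k1 * coeff_C k2 * coeff_D k3 * 2 ^ (k3 + k4)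
            / (fact k1 * fact k2 * fact k3 * fact k4)
            * of_real (ln 2) ^ k4 * cyc_Li_comb k5 x a)"
proof -
  \<comment> \<open>One factor s of s^q cancels against s * Beta s (1/2), so the exponent that
    matters is q - 1.\<close>
  obtain Q where Q: "q = Suc Q" using q by (cases q) auto
  have x: "norm x = 1"
  proof -
    obtain m where m: "m > 0" "x ^ m = 1" using root_of_unity by blast
    have "norm x ^ m = 1" using m(2) by (metis norm_power norm_one)
    thus ?thesis using m(1) power_eq_imp_eq_base[of "norm x" m 1] by simp
  qed
  have Q': "Q > 0 \<or> x \<noteq> 1" using qx Q by auto
  have F: "4 powr (of_int n + a) / ((of_int n + a) ^ q * gen_binomial (2 * of_int n + 2 * a) (of_int n + a)) * x powi (- n)
      = x powi (- n) * (Beta (of_int n + a) (1/2) * inverse (of_int n + a) ^ Q)" for n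
  proof -
    let ?s = "of_int n + a"
    have s: "?s \<notin> \<int>" using a by (metis Ints_diff Ints_of_int add_diff_cancel_left')
    hence nz: "?s \<noteq> 0" by (metis Ints_0)
    have *: "s * b / s ^ Suc Q = b * inverse s ^ Q" if "s \<noteq> 0" for s b :: complex
      using that by (simp add: field_simps)
    have "4 powr ?s / (?s ^ q * gen_binomial (2 * of_int n + 2 * a) ?s) = (4 powr ?s / gen_binomial (2 * ?s) ?s) / ?s ^ q"
      by (simp only: distrib_left divide_divide_eq_left mult.commute)
    also have "\<dots> = Beta ?s (1/2) * inverse ?s ^ Q"
      unfolding four_powr_over_gen_binomial[OF s] Q by (rule *[OF nz])
    finally show ?thesis by (simp only: mult.commute)
  qed
  have Z: "of_nat ((2 * Suc n) choose Suc n) / (of_nat (Suc n) ^ (q - 1) * 4 ^ Suc n) * x ^ Suc n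
      = x ^ Suc n * (of_real (cbinom (Suc n)) * inverse (of_nat (Suc n)) ^ Q)" for n
    unfolding cbinom_def Q by (simp add: divide_inverse power_inverse mult_ac del: power_Suc binomial_Suc_Suc of_nat_Suc mult_Suc_right)
  have "summable (\<lambda>n. x ^ Suc n * (of_real (cbinom (Suc n)) * inverse (of_nat (Suc n)) ^ Q))"
    using summable_cbinom_twisted[OF x Q'] by (subst summable_Suc_iff)
  \<comment> \<open>This sign and the one in \<open>cyc_Li_comb_0\<close> compensate, so the product
    subtracted in the theorem is exactly the contribution of the poles at -m with m > 0.\<close>
  moreover have "q - 1 = Q" "(-1) ^ q = - ((-1) ^ Q :: complex)" by (simp_all add: Q)
  ultimately show ?thesis
    unfolding F Z using bi_summable_Beta_half[OF x a Q'] bi_suminf_Beta_half[OF x a Q']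
    by (simp only: sum_coeffs_eq cyc_Li_comb_0) simp
qed

end
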